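(* Let $\alpha\in\mathcal{P}^0_{\mathcal{A}_K}$ and let $f(x)\in K[x]$ satisfy $f(\alpha)=0$ in $\mathcal{A}_K$. Then $f(x)$ has a root in $K$.
   Context: Let $q$ be a power of a prime number, $R=\mathbb{F}_q[\theta]$, $K=\mathbb{F}_q(\theta)$; $P$ denotes a monic irreducible element of $R$. $\mathcal{A}_K=\big(\prod_P R/(P)\big)/\big(\bigoplus_P R/(P)\big)$, with $[(a_P)_P]$ denoting classes; $K$ embeds diagonally (reduction mod $P$ for $P$ not dividing denominators), so $\mathcal{A}_K$ is a $K$-algebra. For a finite Galois extension $L/K$, $\Gamma=\mathrm{Gal}(L/K)$, $R_L$ the integral closure of $R$ in $L$; for an unramified prime $\mathfrak p$ of $R_L$ over $(P)$, $\varphi_{\mathfrak p}\in\Gamma$ is defined by $\varphi_{\mathfrak p}(x)\equiv x^{q^{\deg P}}\bmod\mathfrak p$ ($x\in R_L$). $A(L)$ is the set of maps $g:\Gamma\to L$ with $g(\sigma\tau\sigma^{-1})=\sigma(g(\tau))$ for all $\sigma,\tau$. For $g\in A(L)$ and all but finitely many $P$, $g(\varphi_{\mathfrak p})\bmod\mathfrak p$ lies in the image of $R/(P)$ and is independent of $\mathfrak p\mid(P)$; write $g(\varphi_P)\bmod P$ for it and $\mathrm{ev}_L(g)=[(g(\varphi_P)\bmod P)_P]$. Then $\mathcal{P}^0_{\mathcal{A}_K}=\bigcup_L\mathrm{ev}_L(A(L))$, the union over finite Galois extensions $L/K$. *)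

theory Defs
  imports
    "HOL-Algebra.Algebraic_Closure_Type"
    "HOL-Algebra.Ideal_Product"
    "HOL-Algebra.Bij"
    "HOL-Library.Cardinality"
begin

text \<open>
  Throughout, \<open>'a :: {field, finite}\<close> is the field with \<open>q = CARD('a)\<close> elements,
  \<open>R\<close> is the type \<open>'a poly\<close> and \<open>K\<close> is the type \<open>'a poly fract\<close>.
  Every finite extension of \<open>K\<close> is \<open>K\<close>-isomorphic to a subfield of the algebraic closure
  \<open>'a poly fract alg_closure\<close>, so the extensions \<open>L\<close> range over such subfields.
\<close>

type_synonym 'a ratfun = "'a poly fract"
type_synonym 'a ratfun_bar = "'a poly fract alg_closure"

abbreviation poly_to_ratfun :: "'a::field poly \<Rightarrow> 'a ratfun"
  where "poly_to_ratfun r \<equiv> Fract r 1"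

abbreviation poly_to_bar :: "'a::field poly \<Rightarrow> 'a ratfun_bar"
  where "poly_to_bar r \<equiv> to_ac (poly_to_ratfun r)"


subsection \<open>The ring \<open>\<A>\<^sub>K\<close>\<close>

definition monic_primes :: "'a::field poly set"
  where "monic_primes = {P. Factorial_Ring.irreducible P \<and> Polynomial.lead_coeff P = 1}"

definition prime_ideal_of :: "'a::field poly \<Rightarrow> 'a poly set"
  where "prime_ideal_of P = PIdl\<^bsub>ring_of_type_algebra\<^esub> P"

definition residue_field :: "'a::field poly \<Rightarrow> 'a poly set ring"
  where "residue_field P = ring_of_type_algebra Quot (prime_ideal_of P)"

definition residue_class :: "'a::field poly \<Rightarrow> 'a poly \<Rightarrow> 'a poly set"
  where "residue_class P r = prime_ideal_of P +>\<^bsub>ring_of_type_algebra\<^esub> r"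

definition product_ring :: "'i set \<Rightarrow> ('i \<Rightarrow> ('b, 'm) ring_scheme) \<Rightarrow> ('i \<Rightarrow> 'b) ring"
  where "product_ring I S =
    \<lparr>carrier = (\<Pi>\<^sub>E i\<in>I. carrier (S i)),
     monoid.mult = (\<lambda>x y. \<lambda>i\<in>I. x i \<otimes>\<^bsub>S i\<^esub> y i),
     one = (\<lambda>i\<in>I. \<one>\<^bsub>S i\<^esub>),
     ring.zero = (\<lambda>i\<in>I. \<zero>\<^bsub>S i\<^esub>),
     add = (\<lambda>x y. \<lambda>i\<in>I. x i \<oplus>\<^bsub>S i\<^esub> y i)\<rparr>"

definition direct_sum :: "'i set \<Rightarrow> ('i \<Rightarrow> ('b, 'm) ring_scheme) \<Rightarrow> ('i \<Rightarrow> 'b) set"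
  where "direct_sum I S =
    {x \<in> carrier (product_ring I S). finite {i \<in> I. x i \<noteq> \<zero>\<^bsub>S i\<^esub>}}"

definition AK :: "('a::field poly \<Rightarrow> 'a poly set) set ring"
  where "AK = product_ring monic_primes residue_field Quot direct_sum monic_primes residue_field"

text \<open>The class \<open>[(a\<^sub>P)\<^sub>P]\<close>.\<close>

definition AK_class :: "('a::field poly \<Rightarrow> 'a poly set) \<Rightarrow> ('a poly \<Rightarrow> 'a poly set) set"
  where "AK_class a = direct_sum monic_primes residue_field
           +>\<^bsub>product_ring monic_primes residue_field\<^esub> restrict a monic_primes"

text \<open>
  For a subring \<open>D\<close> of a field and a prime ideal \<open>\<pp>\<close> of \<open>D\<close>: the difference \<open>x - y\<close> lies in
  the maximal ideal \<open>\<pp>D\<^sub>\<pp>\<close> of the localization. For \<open>y \<in> D\<close> this says that \<open>x\<close> lies in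
  \<open>D\<^sub>\<pp>\<close> and that \<open>x mod \<pp> = y mod \<pp>\<close>.
\<close>

definition cong_at :: "'k::field set \<Rightarrow> 'k set \<Rightarrow> 'k \<Rightarrow> 'k \<Rightarrow> bool"
  where "cong_at D \<pp> x y \<longleftrightarrow> (\<exists>s\<in>D - \<pp>. s * (x - y) \<in> \<pp>)"

text \<open>
  Both this reduction and \<open>frobenius_value\<close> below are set to \<open>0\<close> at the finitely many \<open>P\<close> where
  they are not defined; the class in \<open>\<A>\<^sub>K\<close> does not depend on these values. Where a
  representative \<open>r\<close> exists, its class modulo \<open>P\<close> is unique.
\<close>

definition reduce_ratfun :: "'a::field poly \<Rightarrow> 'a ratfun \<Rightarrow> 'a poly set"
  where "reduce_ratfun P k =
    (let represents = (\<lambda>r. cong_at (range poly_to_ratfun) (poly_to_ratfun ` prime_ideal_of P)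
                             k (poly_to_ratfun r))
     in if \<exists>r. represents r then residue_class P (SOME r. represents r)
        else \<zero>\<^bsub>residue_field P\<^esub>)"

definition ratfun_to_AK :: "'a::field ratfun \<Rightarrow> ('a poly \<Rightarrow> 'a poly set) set"
  where "ratfun_to_AK k = AK_class (\<lambda>P. reduce_ratfun P k)"

definition AK_eval :: "'a::field ratfun poly \<Rightarrow> ('a poly \<Rightarrow> 'a poly set) set
                         \<Rightarrow> ('a poly \<Rightarrow> 'a poly set) set"
  where "AK_eval f \<alpha> =
    (\<Oplus>\<^bsub>AK\<^esub> i \<in> {..Polynomial.degree f}. ratfun_to_AK (Polynomial.coeff f i) \<otimes>\<^bsub>AK\<^esub> (\<alpha> [^]\<^bsub>AK\<^esub> i))"


subsection \<open>Finite Galois extensions of \<open>K\<close> and Frobenius elements\<close>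

text \<open>Automorphisms are extensional functions on \<open>L\<close>, so that \<open>\<Gamma>\<close> has no duplicates.\<close>

definition galois_group :: "'a::field ratfun_bar set \<Rightarrow> ('a ratfun_bar \<Rightarrow> 'a ratfun_bar) monoid"
  where "galois_group L = BijGroup L
    \<lparr>carrier := {\<sigma> \<in> Bij L. \<sigma> \<in> ring_hom (ring_of_type_algebra\<lparr>carrier := L\<rparr>)
                                           (ring_of_type_algebra\<lparr>carrier := L\<rparr>)
                            \<and> (\<forall>k. \<sigma> (to_ac k) = to_ac k)}\<rparr>"

definition finite_galois :: "'a::field ratfun_bar set \<Rightarrow> bool"
  where "finite_galois L \<longleftrightarrow>
    subfield L ring_of_type_algebra \<and>
    range to_ac \<subseteq> L \<and>
    ring.finite_dimension ring_of_type_algebra (range to_ac) L \<and>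
    {x \<in> L. \<forall>\<sigma>\<in>carrier (galois_group L). \<sigma> x = x} = range to_ac"

definition integral_closure_in :: "'a::field ratfun_bar set \<Rightarrow> 'a ratfun_bar set"
  where "integral_closure_in L =
    {x \<in> L. \<exists>p :: 'a poly poly. Polynomial.lead_coeff p = 1 \<and> poly (map_poly poly_to_bar p) x = 0}"

abbreviation integral_closure_ring :: "'a::field ratfun_bar set \<Rightarrow> 'a ratfun_bar ring"
  where "integral_closure_ring L \<equiv> ring_of_type_algebra\<lparr>carrier := integral_closure_in L\<rparr>"

definition primes_over :: "'a::field ratfun_bar set \<Rightarrow> 'a poly \<Rightarrow> 'a ratfun_bar set set"
  where "primes_over L P =
    {\<pp>. primeideal \<pp> (integral_closure_ring L) \<and> {r. poly_to_bar r \<in> \<pp>} = prime_ideal_of P}"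

text \<open>
  For \<open>\<pp>\<close> over \<open>(P)\<close>: the ramification index, i.e. the exponent of \<open>\<pp>\<close> in \<open>P R\<^sub>L\<close>, is \<open>1\<close>.
  The residue extension is separable since residue fields are finite.
\<close>

definition unramified :: "'a::field ratfun_bar set \<Rightarrow> 'a poly \<Rightarrow> 'a ratfun_bar set \<Rightarrow> bool"
  where "unramified L P \<pp> \<longleftrightarrow> poly_to_bar P \<notin> ideal_prod (integral_closure_ring L) \<pp> \<pp>"

definition frobenius :: "'a::{field, finite} ratfun_bar set \<Rightarrow> 'a poly \<Rightarrow> 'a ratfun_bar set
                           \<Rightarrow> ('a ratfun_bar \<Rightarrow> 'a ratfun_bar)"
  where "frobenius L P \<pp> =
    (THE \<sigma>. \<sigma> \<in> carrier (galois_group L) \<and>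
       (\<forall>x\<in>integral_closure_in L. \<sigma> x - x ^ (CARD('a) ^ Polynomial.degree P) \<in> \<pp>))"


subsection \<open>The evaluation maps and \<open>\<P>\<^sup>0\<close>\<close>

definition equivariant_maps ::
    "'a::field ratfun_bar set \<Rightarrow> (('a ratfun_bar \<Rightarrow> 'a ratfun_bar) \<Rightarrow> 'a ratfun_bar) set"
  where "equivariant_maps L =
    {g \<in> carrier (galois_group L) \<rightarrow>\<^sub>E L.
       \<forall>\<sigma>\<in>carrier (galois_group L). \<forall>\<tau>\<in>carrier (galois_group L).
         g (\<sigma> \<otimes>\<^bsub>galois_group L\<^esub> \<tau> \<otimes>\<^bsub>galois_group L\<^esub> inv\<^bsub>galois_group L\<^esub> \<sigma>) = \<sigma> (g \<tau>)}"

text \<open>\<open>g(\<phi>\<^sub>P) mod P\<close>\<close>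

definition frobenius_value :: "'a::{field, finite} ratfun_bar set
      \<Rightarrow> (('a ratfun_bar \<Rightarrow> 'a ratfun_bar) \<Rightarrow> 'a ratfun_bar) \<Rightarrow> 'a poly \<Rightarrow> 'a poly set"
  where "frobenius_value L g P =
    (let represents = (\<lambda>r. \<forall>\<pp>\<in>primes_over L P. unramified L P \<pp> \<and>
           cong_at (integral_closure_in L) \<pp> (g (frobenius L P \<pp>)) (poly_to_bar r))
     in if \<exists>r. represents r then residue_class P (SOME r. represents r)
        else \<zero>\<^bsub>residue_field P\<^esub>)"

definition ev :: "'a::{field, finite} ratfun_bar set
      \<Rightarrow> (('a ratfun_bar \<Rightarrow> 'a ratfun_bar) \<Rightarrow> 'a ratfun_bar) \<Rightarrow> ('a poly \<Rightarrow> 'a poly set) set"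
  where "ev L g = AK_class (frobenius_value L g)"

definition P0_AK :: "('a::{field, finite} poly \<Rightarrow> 'a poly set) set set"
  where "P0_AK = (\<Union>L\<in>{L. finite_galois L}. ev L ` equivariant_maps L)"

end

theory Submission
  imports Defs "Jordan_Normal_Form.Char_Poly"
begin

text \<open>
  If \<open>\<alpha> = ev\<^sub>L g\<close>, equivariance makes \<open>g(1)\<close> Galois invariant, so \<open>g(1) = k \<in> K\<close>. At a prime \<open>P\<close> whose
  Frobenius elements are all trivial, \<open>\<alpha>\<close> reduces to \<open>k mod P\<close>, hence \<open>f(k) \<equiv> 0 mod P\<close>; as there are
  infinitely many such \<open>P\<close>, \<open>f(k) = 0\<close>.

  No density theorem is needed for the infinitude. Let \<open>\<beta>\<close> be an integral primitive element of \<open>L/K\<close>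
  and \<open>M = \<Prod>\<^sub>\<sigma> (t - \<sigma>\<beta>) \<in> R[t]\<close>. Infinitely many \<open>P\<close> divide a value \<open>M(r)\<close>. If such a \<open>P\<close> does not divide
  the norm of \<open>\<Prod>\<^bsub>\<sigma>\<noteq>\<tau>\<^esub> (\<sigma>\<beta> - \<tau>\<beta>)\<close> and \<open>\<pp>\<close> lies over \<open>P\<close>, then some conjugate \<open>b\<close> of \<open>\<beta>\<close> satisfies
  \<open>r \<equiv> b mod \<pp>\<close>, while \<open>e = \<Prod>\<^bsub>\<tau>\<noteq>1\<^esub> (r - \<tau>b) \<notin> \<pp>\<close>. For integral \<open>x\<close> the invariant sum
  \<open>h\<^sub>x = \<Sum>\<^sub>\<sigma> \<sigma>(x) \<Prod>\<^bsub>\<tau>\<noteq>\<sigma>\<^esub> (r - \<tau>b)\<close> lies in \<open>R\<close>, and \<open>h\<^sub>x - e x\<close> is a multiple of \<open>r - b\<close>. So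
  \<open>x \<equiv> h\<^sub>x / h\<^sub>1 mod \<pp>\<close>: the residue degree is one and the Frobenius is trivial. As \<open>e (r - b) = M(r)\<close> is
  a multiple of \<open>P\<close>, also \<open>e\<^sup>2 \<pp> \<subseteq> P R\<^sub>L\<close>, whence \<open>P \<notin> \<pp>\<^sup>2\<close>.
\<close>

hide_const (open) Divisibility.prime Divisibility.irreducible

section \<open>Residues modulo a prime of R and primes dividing polynomial values\<close>

subsection \<open>Polynomials over a finite field\<close>

text \<open>Vanishing coefficients, rather than a bound on the degree, include the zero polynomial
  uniformly, also for \<open>d = 0\<close>. Splitting off the constant coefficient contributes one
  factor q per induction step.\<close>

lemma finite_card_poly_coeffs_below:
  "finite {p :: 'a::{field, finite} poly. \<forall>i\<ge>d. Polynomial.coeff p i = 0} \<and>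
   card {p :: 'a poly. \<forall>i\<ge>d. Polynomial.coeff p i = 0} = CARD('a) ^ d"
proof (induction d)
  case 0
  have "{p :: 'a poly. \<forall>i\<ge>0. Polynomial.coeff p i = 0} = {0}"
    by (auto intro: poly_eqI)
  then show ?case
    by simp
next
  case (Suc d)
  let ?A = "\<lambda>d. {p :: 'a poly. \<forall>i\<ge>d. Polynomial.coeff p i = 0}"
  have eq: "?A (Suc d) = case_prod pCons ` (UNIV \<times> ?A d)"
  proof (intro equalityI subsetI)
    fix p assume p: "p \<in> ?A (Suc d)"
    obtain a q where pq: "p = pCons a q"
      by (cases p)
    with p have "\<forall>i\<ge>d. Polynomial.coeff q i = 0"
      by (metis (mono_tags, lifting) Suc_le_mono coeff_pCons_Suc mem_Collect_eq)
    with pq show "p \<in> case_prod pCons ` (UNIV \<times> ?A d)"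
      by auto
  next
    fix p assume "p \<in> case_prod pCons ` (UNIV \<times> ?A d)"
    then show "p \<in> ?A (Suc d)"
      by (auto simp: coeff_pCons split: nat.splits)
  qed
  have inj: "inj_on (case_prod pCons) (UNIV \<times> ?A d)"
    by (auto simp: inj_on_def)
  show ?case
    unfolding eq using Suc by (auto simp: card_image[OF inj] card_cartesian_product)
qed

lemma mem_residues_iff:
  "(P :: 'a::field poly) \<noteq> 0 \<Longrightarrow> (\<forall>i\<ge>Polynomial.degree P. Polynomial.coeff p i = 0) \<longleftrightarrow> p mod P = p"
proof
  assume P: "P \<noteq> 0" and "\<forall>i\<ge>Polynomial.degree P. Polynomial.coeff p i = 0"
  then have "p = 0 \<or> Polynomial.degree p < Polynomial.degree P"
    by (metis leading_coeff_neq_0 not_le)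
  then show "p mod P = p"
    by (auto simp: mod_poly_less)
next
  assume P: "P \<noteq> 0" and "p mod P = p"
  then have "p = 0 \<or> Polynomial.degree p < Polynomial.degree P"
    using degree_mod_less[OF P, of p] by auto
  then show "\<forall>i\<ge>Polynomial.degree P. Polynomial.coeff p i = 0"
    by (auto simp: coeff_eq_0)
qed

text \<open>The fixed points of \<open>mod P\<close> are the canonical representatives of R/(P), so
  this is the count |R/(P)| = q^deg P without passing to the quotient ring.\<close>

lemma finite_card_residues:
  assumes "(P :: 'a::{field, finite} poly) \<noteq> 0"
  shows "finite {p. p mod P = p}" "card {p. p mod P = p} = CARD('a) ^ Polynomial.degree P"
  using finite_card_poly_coeffs_below[of "Polynomial.degree P", where 'a = 'a]
  by (simp_all add: mem_residues_iff[OF assms])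

lemma irreducible_dvd_mult_iff:
  assumes "irreducible (P :: 'a::field poly)"
  shows "P dvd u * v \<longleftrightarrow> P dvd u \<or> P dvd v"
  using field_poly_irreducible_imp_prime[OF assms] prime_elem_dvd_mult_iff by blast

lemma irreducible_dvd_power:
  assumes "irreducible (P :: 'a::field poly)" "P dvd u ^ n"
  shows "P dvd u"
  using field_poly_irreducible_imp_prime[OF assms(1)] assms(2) prime_elem_dvd_power by blast

text \<open>Cancelling v modulo the prime P gives injectivity; finiteness of the set of residues
  turns this into surjectivity. Inverses modulo P and Fermat's theorem both rest on it.\<close>

lemma bij_betw_mult_residues:
  assumes P: "irreducible (P :: 'a::{field, finite} poly)" and v: "\<not> P dvd v"
  shows "bij_betw (\<lambda>p. v * p mod P) {p. p mod P = p} {p. p mod P = p}"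
proof -
  have P0: "P \<noteq> 0" using P by auto
  have inj: "inj_on (\<lambda>p. v * p mod P) {p. p mod P = p}"
  proof (rule inj_onI)
    fix p p' assume *: "p \<in> {p. p mod P = p}" "p' \<in> {p. p mod P = p}"
      and "v * p mod P = v * p' mod P"
    then have "P dvd v * (p - p')"
      by (metis mod_eq_dvd_iff right_diff_distrib')
    then have "P dvd p - p'"
      using irreducible_dvd_mult_iff[OF P] v by blast
    then have "p mod P = p' mod P"
      by (simp add: mod_eq_dvd_iff)
    then show "p = p'"
      using * by simp
  qed
  have "(\<lambda>p. v * p mod P) ` {p. p mod P = p} \<subseteq> {p. p mod P = p}"
    by auto
  with inj show ?thesis
    using endo_inj_surj[OF finite_card_residues(1)[OF P0]] by (auto simp: bij_betw_def)
qed

lemma irreducible_inverse_mod: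
  assumes P: "irreducible (P :: 'a::{field, finite} poly)" and v: "\<not> P dvd v"
  obtains w where "P dvd v * w - 1"
proof -
  have "1 mod P \<in> {p. p mod P = p}"
    by simp
  then obtain w where "v * w mod P = 1 mod P"
    using bij_betw_mult_residues[OF P v] unfolding bij_betw_def by (metis (no_types, lifting) imageE)
  then show ?thesis
    using that by (auto simp: mod_eq_dvd_iff)
qed

lemma irreducible_dvd_prod:
  assumes "irreducible (P :: 'a::field poly)" "P dvd prod f A"
  shows "\<exists>a\<in>A. P dvd f a"
  using assms(2)
proof (induction A rule: infinite_finite_induct)
  case (insert a A)
  then show ?case
    using irreducible_dvd_mult_iff[OF assms(1)] by auto
qed (use assms(1) in \<open>auto simp: irreducible_def\<close>)

text \<open>Fermat's little theorem in R/(P). If P does not divide h, multiplication by h permutes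
  the nonzero residues, and comparing the products before and after gives h^(|R/(P)| - 1) = 1 modulo
  P.\<close>

lemma irreducible_dvd_frobenius_diff:
  assumes P: "irreducible (P :: 'a::{field, finite} poly)"
  shows "P dvd h ^ (CARD('a) ^ Polynomial.degree P) - h"
proof (cases "P dvd h")
  case True
  then show ?thesis
    by (intro dvd_diff dvd_trans[OF True dvd_power]) auto
next
  case False
  have P0: "P \<noteq> 0" using P by auto
  define S where "S = {p. p mod P = p} - {0}"
  have fin: "finite S"
    unfolding S_def using finite_card_residues(1)[OF P0] by blast
  have "card S = CARD('a) ^ Polynomial.degree P - 1"
    unfolding S_def by (simp add: finite_card_residues[OF P0])
  then have card: "Suc (card S) = CARD('a) ^ Polynomial.degree P"
    by simp
  have bij: "bij_betw (\<lambda>p. h * p mod P) S S"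
    unfolding S_def
    using bij_betw_DiffI[OF bij_betw_mult_residues[OF P False], of "{0}" "{0}"]
    by (simp add: bij_betw_def)
  have "(\<Prod>p\<in>S. p) mod P = (\<Prod>p\<in>S. h * p mod P) mod P"
    using prod.reindex_bij_betw[OF bij, of id] by simp
  also have "\<dots> = (\<Prod>p\<in>S. h * p) mod P"
    by (rule mod_prod_eq)
  also have "\<dots> = (h ^ card S * (\<Prod>p\<in>S. p)) mod P"
    by (simp add: prod.distrib)
  finally have "P dvd (h ^ card S - 1) * (\<Prod>p\<in>S. p)"
    by (metis mod_eq_dvd_iff left_diff_distrib' mult_1)
  \<comment> \<open>The factors are nonzero residues and hence prime to P, so their product can be
    cancelled.\<close>
  moreover have "\<not> P dvd (\<Prod>p\<in>S. p)"
  proof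
    assume "P dvd (\<Prod>p\<in>S. p)"
    then obtain p where "p \<in> S" "P dvd p"
      using irreducible_dvd_prod[OF P] by blast
    then show False
      unfolding S_def by auto
  qed
  ultimately have "P dvd h ^ card S - 1"
    using irreducible_dvd_mult_iff[OF P] by blast
  then have "P dvd h * (h ^ card S - 1)"
    by simp
  then show ?thesis
    by (simp flip: card add: algebra_simps)
qed

lemma exists_monic_prime_dvd:
  assumes "Polynomial.degree (v :: 'a::field poly) > 0"
  shows "\<exists>P\<in>monic_primes. P dvd v"
  using assms
proof (induction "Polynomial.degree v" arbitrary: v rule: less_induct)
  case less
  have v0: "v \<noteq> 0" using less.prems by auto
  show ?case
  proof (cases "irreducible v")
    case True
    define P where "P = Polynomial.smult (inverse (Polynomial.lead_coeff v)) v"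
    have "irreducible P"
      unfolding P_def using True v0 by (simp add: irreducible_smult_field)
    moreover have "Polynomial.lead_coeff P = 1"
      unfolding P_def using v0 by simp
    moreover have "P dvd v"
      unfolding P_def using v0 by (simp add: smult_dvd)
    ultimately show ?thesis
      by (auto simp: monic_primes_def)
  next
    case False
    then obtain a b where ab: "v = a * b" "\<not> is_unit a" "\<not> is_unit b"
      using v0 less.prems unfolding irreducible_def by (auto simp: is_unit_iff_degree)
    have "a \<noteq> 0" "b \<noteq> 0"
      using ab v0 by auto
    then have "Polynomial.degree a > 0" "Polynomial.degree b > 0"
      using ab is_unit_iff_degree by blast+
    then have "Polynomial.degree a < Polynomial.degree v"
      using \<open>a \<noteq> 0\<close> \<open>b \<noteq> 0\<close> by (simp add: ab degree_mult_eq)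
    from less.hyps[OF this] \<open>Polynomial.degree a > 0\<close> show ?thesis
      using ab by (meson dvd_mult2)
  qed
qed

text \<open>Divisors of N have bounded degree, and over a finite field only finitely many
  polynomials have bounded degree.\<close>

lemma finite_monic_primes_dvd:
  assumes "(N :: 'a::{field, finite} poly) \<noteq> 0"
  shows "finite {P \<in> monic_primes. P dvd N}"
proof (rule finite_subset)
  show "{P \<in> monic_primes. P dvd N} \<subseteq> {p. \<forall>i\<ge>Suc (Polynomial.degree N). Polynomial.coeff p i = 0}"
  proof safe
    fix P :: "'a poly" and i
    assume "P dvd N" "i \<ge> Suc (Polynomial.degree N)"
    then have "Polynomial.degree P < i"
      using dvd_imp_degree_le[OF \<open>P dvd N\<close> assms] by simp
    then show "Polynomial.coeff P i = 0"
      by (rule coeff_eq_0)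
  qed
  show "finite {p :: 'a poly. \<forall>i\<ge>Suc (Polynomial.degree N). Polynomial.coeff p i = 0}"
    using finite_card_poly_coeffs_below by blast
qed

lemma infinite_UNIV_poly: "infinite (UNIV :: 'a::field poly set)"
proof
  assume "finite (UNIV :: 'a poly set)"
  moreover have "inj (\<lambda>n. Polynomial.monom (1 :: 'a) n)"
    by (auto simp: inj_def monom_eq_iff')
  ultimately show False
    using finite_imageD finite_subset[OF subset_UNIV] infinite_UNIV_nat by metis
qed

lemma diff_dvd_poly_diff: "x - y dvd poly p x - poly p (y :: 'a::comm_ring_1)"
proof (induction p)
  case (pCons a p)
  have "poly (pCons a p) x - poly (pCons a p) y = x * (poly p x - poly p y) + (x - y) * poly p y"
    by (simp add: algebra_simps)
  then show ?case
    using pCons by simp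
qed simp

text \<open>If the set S of these primes were finite, M would take only values c u with u a unit on
  an infinite progression c_0 + Q s. There are finitely many units, and M takes each value only
  finitely often.\<close>

lemma infinite_monic_primes_dvd_values:
  assumes M: "Polynomial.degree (M :: 'a::{field, finite} poly poly) > 0"
  shows "infinite {P \<in> monic_primes. \<exists>r. P dvd poly M r}" (is "infinite ?S")
proof
  assume fin: "finite ?S"
  obtain c0 where c0: "poly M c0 \<noteq> 0"
  proof -
    have "finite {x. poly M x = 0}"
      using M by (intro poly_roots_finite) auto
    then have "{x. poly M x = 0} \<noteq> UNIV"
      using infinite_UNIV_poly by metis
    then show ?thesis
      using that by blast
  qed
  define c where "c = poly M c0"
  define W where "W = \<Prod>?S"
  \<comment> \<open>The factor c allows c to be split off every value M(c_0 + Q s); the factor W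
    makes the cofactor congruent to 1 modulo every prime in S.\<close>
  define Q where "Q = c * W"
  have "W \<noteq> 0"
    unfolding W_def using fin by (auto simp: monic_primes_def)
  then have Q0: "Q \<noteq> 0"
    using c0 by (simp add: Q_def c_def)
  have W: "P dvd W" if "P \<in> ?S" for P
    unfolding W_def using dvd_prodI[OF fin that, of "\<lambda>x. x"] .
  \<comment> \<open>Euclid: \<open>M (c\<^sub>0 + Q s) = c (1 + W s \<dots>)\<close> has a prime factor outside \<open>S\<close> unless the second
    factor is a unit.\<close>
  have unit: "\<exists>u. is_unit u \<and> poly M (c0 + Q * s) = c * u" for s
  proof -
    have "(c0 + Q * s) - c0 dvd poly M (c0 + Q * s) - poly M c0"
      by (rule diff_dvd_poly_diff)
    then obtain t where "poly M (c0 + Q * s) - c = Q * s * t"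
      unfolding c_def by (auto simp: dvd_def)
    then have eq: "poly M (c0 + Q * s) = c * (1 + W * (s * t))"
      unfolding Q_def by (simp add: algebra_simps)
    define u where "u = 1 + W * (s * t)"
    have "is_unit u"
    proof (rule ccontr)
      assume "\<not> is_unit u"
      then have "u = 0 \<or> Polynomial.degree u > 0"
        using is_unit_iff_degree by blast
      \<comment> \<open>This covers the case u = 0, which every prime divides: it suffices to
        exhibit one monic prime.\<close>
      moreover have "\<exists>P\<in>(monic_primes :: 'a poly set). P dvd [:0, 1:]"
        by (rule exists_monic_prime_dvd) simp
      ultimately obtain P where P: "P \<in> monic_primes" "P dvd u"
        using exists_monic_prime_dvd by blast
      then have "P dvd poly M (c0 + Q * s)"
        unfolding eq u_def by simp
      then have "P dvd W"
        using P W by blast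
      then have "P dvd u - W * (s * t)"
        using P(2) by (intro dvd_diff dvd_mult2)
      then have "P dvd 1"
        by (simp add: u_def)
      then show False
        using P(1) by (auto simp: monic_primes_def irreducible_def)
    qed
    then show ?thesis
      using eq unfolding u_def by blast
  qed
  have "finite {u :: 'a poly. is_unit u}"
  proof (rule finite_subset)
    show "{u :: 'a poly. is_unit u} \<subseteq> range (\<lambda>a. [:a:])"
      by (auto simp: is_unit_iff_degree elim!: degree_eq_zeroE)
  qed simp
  \<comment> \<open>All points where M takes one of the values c u; M has positive degree, so M - c
    u is never the zero polynomial.\<close>
  then have "finite (\<Union>u\<in>{u. is_unit u}. {x. poly (M - [:c * u:]) x = 0})"
  proof (rule finite_UN_I)
    fix u
    have "M - [:c * u:] \<noteq> 0"
      using M by auto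
    then show "finite {x. poly (M - [:c * u:]) x = 0}"
      by (rule poly_roots_finite)
  qed
  moreover have "range (\<lambda>s. c0 + Q * s) \<subseteq> (\<Union>u\<in>{u. is_unit u}. {x. poly (M - [:c * u:]) x = 0})"
    using unit by fastforce
  moreover have "inj (\<lambda>s. c0 + Q * s)"
    using Q0 by (auto simp: inj_def)
  ultimately show False
    using infinite_UNIV_poly finite_imageD finite_subset by metis
qed

section \<open>Integrality over R: determinant trick, integral closedness of R, denominators\<close>

subsection \<open>Integral elements\<close>

text \<open>The same map as \<open>poly_to_bar\<close>, written with \<open>to_fract\<close>, whose
  homomorphism rules the simplifier can use.\<close>

definition emb :: "'a::field poly \<Rightarrow> 'a ratfun_bar"
  where "emb r = to_ac (to_fract r)"

lemma poly_to_bar_eq_emb: "poly_to_bar r = emb r"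
  by (simp add: emb_def to_fract_def)

lemma emb_simps [simp]:
  "emb 0 = 0" "emb 1 = 1" "emb (r + s) = emb r + emb s" "emb (r * s) = emb r * emb s"
  "emb (r - s) = emb r - emb s" "emb (- r) = - emb r" "emb (r ^ n) = emb r ^ n"
  "emb r = emb s \<longleftrightarrow> r = s" "emb r = 0 \<longleftrightarrow> r = 0"
proof -
  have "to_fract (r ^ n) = to_fract r ^ n"
    by (induction n) auto
  then show "emb (r ^ n) = emb r ^ n"
    by (simp add: emb_def)
qed (simp_all add: emb_def)

lemma emb_sum: "emb (sum f A) = (\<Sum>x\<in>A. emb (f x))"
  by (induction A rule: infinite_finite_induct) auto

definition integral_elem :: "'a::field ratfun_bar \<Rightarrow> bool"
  where "integral_elem x \<longleftrightarrow> (\<exists>p. Polynomial.lead_coeff p = 1 \<and> poly (map_poly emb p) x = 0)"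

lemma integral_closure_in_eq: "integral_closure_in L = {x \<in> L. integral_elem x}"
  by (simp add: integral_closure_in_def integral_elem_def poly_to_bar_eq_emb)

text \<open>The R-submodule generated by V, intended for finite V: for infinite V all the sums are 0
  by convention.\<close>

definition emb_span :: "'a::field ratfun_bar set \<Rightarrow> 'a ratfun_bar set"
  where "emb_span V = range (\<lambda>c. \<Sum>v\<in>V. emb (c v) * v)"

lemma emb_span_base:
  assumes "finite V" "v \<in> V"
  shows "v \<in> emb_span V"
proof -
  have "(\<Sum>w\<in>V. emb (if w = v then 1 else 0) * w) = (\<Sum>w\<in>V. if w = v then v else 0)"
    by (intro sum.cong) auto
  then have "v = (\<Sum>w\<in>V. emb (if w = v then 1 else 0) * w)"
    using assms by simp
  then show ?thesis
    unfolding emb_span_def by - (rule range_eqI)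
qed

lemma emb_span_add:
  assumes "x \<in> emb_span V" "y \<in> emb_span V"
  shows "x + y \<in> emb_span V"
proof -
  obtain c d where "x = (\<Sum>v\<in>V. emb (c v) * v)" "y = (\<Sum>v\<in>V. emb (d v) * v)"
    using assms by (auto simp: emb_span_def)
  then have "x + y = (\<Sum>v\<in>V. emb (c v + d v) * v)"
    by (simp add: algebra_simps sum.distrib)
  then show ?thesis
    unfolding emb_span_def by - (rule range_eqI)
qed

lemma emb_span_scale:
  assumes "x \<in> emb_span V"
  shows "emb r * x \<in> emb_span V"
proof -
  obtain c where "x = (\<Sum>v\<in>V. emb (c v) * v)"
    using assms by (auto simp: emb_span_def)
  then have "emb r * x = (\<Sum>v\<in>V. emb (r * c v) * v)"
    by (simp add: algebra_simps sum_distrib_left)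
  then show ?thesis
    unfolding emb_span_def by - (rule range_eqI)
qed

lemma emb_span_uminus: "x \<in> emb_span V \<Longrightarrow> - x \<in> emb_span V"
  using emb_span_scale[of x V "- 1"] by simp

lemma emb_span_zero: "0 \<in> emb_span V"
proof -
  have "0 = (\<Sum>v\<in>V. emb 0 * v)"
    by simp
  then show ?thesis
    unfolding emb_span_def by - (rule range_eqI)
qed

lemma emb_span_sum:
  assumes "\<And>a. a \<in> A \<Longrightarrow> f a \<in> emb_span V"
  shows "sum f A \<in> emb_span V"
  using assms
  by (induction A rule: infinite_finite_induct) (auto intro: emb_span_zero emb_span_add)

lemma emb_span_mult_mem:
  assumes "\<And>v. v \<in> V \<Longrightarrow> x * v \<in> emb_span V" "w \<in> emb_span V"
  shows "x * w \<in> emb_span V"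
proof -
  obtain c where "w = (\<Sum>v\<in>V. emb (c v) * v)"
    using assms(2) by (auto simp: emb_span_def)
  then have "x * w = (\<Sum>v\<in>V. emb (c v) * (x * v))"
    by (simp add: sum_distrib_left mult.left_commute)
  then show ?thesis
    using assms(1) by (auto intro!: emb_span_sum emb_span_scale)
qed

text \<open>The determinant trick: \<open>z\<close> is an eigenvalue of a matrix over \<open>R\<close>.\<close>

lemma integral_elem_if_emb_span_stable:
  assumes V: "finite V" and nz: "\<exists>v\<in>V. v \<noteq> 0"
    and stable: "\<And>v. v \<in> V \<Longrightarrow> z * v \<in> emb_span V"
  shows "integral_elem z"
proof -
  obtain h where h: "bij_betw h {0..<card V} V"
    using ex_bij_betw_nat_finite[OF V] by blast
  define n where "n = card V"
  have "\<forall>v\<in>V. \<exists>c. z * v = (\<Sum>w\<in>V. emb (c w) * w)"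
    using stable unfolding emb_span_def image_iff by blast
  then obtain c where c: "\<And>v. v \<in> V \<Longrightarrow> z * v = (\<Sum>w\<in>V. emb (c v w) * w)"
    by metis
  define A where "A = mat n n (\<lambda>(i, j). c (h i) (h j))"
  have A: "A \<in> carrier_mat n n"
    by (simp add: A_def)
  interpret emb: comm_ring_hom emb
    by unfold_locales auto
  have hV: "h i \<in> V" if "i < n" for i
    using h that unfolding n_def by (auto simp: bij_betw_def)
  \<comment> \<open>The list of generators is itself the eigenvector. Linear independence plays no
    part in this, only that some generator is nonzero.\<close>
  have "eigenvector (map_mat emb A) (vec n h) z"
    unfolding eigenvector_def
  proof (intro conjI)
    show "vec n h \<in> carrier_vec (dim_row (map_mat emb A))"
      using A by simp
    show "vec n h \<noteq> 0\<^sub>v (dim_row (map_mat emb A))"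
    proof
      assume *: "vec n h = 0\<^sub>v (dim_row (map_mat emb A))"
      obtain v where "v \<in> V" "v \<noteq> 0"
        using nz by blast
      then obtain i where "i < n" "h i \<noteq> 0"
        using h unfolding n_def bij_betw_def by (metis atLeastLessThan_iff imageE)
      then show False
        using arg_cong[OF *, of "\<lambda>w. vec_index w i"] A by simp
    qed
    show "map_mat emb A *\<^sub>v vec n h = z \<cdot>\<^sub>v vec n h"
    proof (rule eq_vecI)
      fix i assume "i < dim_vec (z \<cdot>\<^sub>v vec n h)"
      then have i: "i < n"
        by simp
      have "(map_mat emb A *\<^sub>v vec n h) $ i = (\<Sum>j\<in>{0..<n}. emb (c (h i) (h j)) * h j)"
        using i A by (auto simp: scalar_prod_def A_def intro!: sum.cong)
      also have "\<dots> = (\<Sum>w\<in>V. emb (c (h i) w) * w)"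
        using sum.reindex_bij_betw[OF h, of "\<lambda>w. emb (c (h i) w) * w"] by (simp add: n_def)
      also have "\<dots> = z * h i"
        using c[OF hV[OF i]] by simp
      finally show "(map_mat emb A *\<^sub>v vec n h) $ i = (z \<cdot>\<^sub>v vec n h) $ i"
        using i by simp
    qed (use A in simp)
  qed
  then have "eigenvalue (map_mat emb A) z"
    unfolding eigenvalue_def by blast
  then have "poly (map_poly emb (char_poly A)) z = 0"
    using eigenvalue_root_char_poly[of "map_mat emb A" n z] A emb.char_poly_hom[OF A] by simp
  then show ?thesis
    unfolding integral_elem_def using degree_monic_char_poly[OF A] by auto
qed

lemma poly_map_poly_emb: "poly (map_poly emb p) x = (\<Sum>i\<le>Polynomial.degree p. emb (Polynomial.coeff p i) * x ^ i)"
proof -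
  have "Polynomial.degree (map_poly emb p) = Polynomial.degree p"
    by (rule degree_map_poly) simp
  then show ?thesis
    by (simp add: poly_altdef coeff_map_poly)
qed

lemma integral_elemE:
  assumes "integral_elem x"
  obtains n c where "n > 0" "x ^ n = (\<Sum>i<n. emb (c i) * x ^ i)"
proof -
  obtain p where p: "Polynomial.lead_coeff p = 1" "poly (map_poly emb p) x = 0"
    using assms by (auto simp: integral_elem_def)
  define n where "n = Polynomial.degree p"
  have "(\<Sum>i<n. emb (Polynomial.coeff p i) * x ^ i) + x ^ n = 0"
    using p by (simp add: poly_map_poly_emb lessThan_Suc_atMost[symmetric] n_def[symmetric])
  then have eq: "x ^ n = (\<Sum>i<n. emb (- Polynomial.coeff p i) * x ^ i)"
    by (simp add: sum_negf add_eq_0_iff)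
  then have "n > 0"
    by (cases n) auto
  then show ?thesis
    using eq by (rule that)
qed

text \<open>The common core of closure under sums and products. The monomials x^i y^j with i < m and
  j < n span an R-module stable under x and y, because the monic equations rewrite x^m and y^n; by
  hypothesis z then stabilizes it too, and the determinant trick applies.\<close>

lemma integral_elem_if_adjoin:
  assumes "integral_elem x" "integral_elem y"
    and z: "\<And>V. finite V \<Longrightarrow> (\<And>v. v \<in> V \<Longrightarrow> x * v \<in> emb_span V) \<Longrightarrow> (\<And>v. v \<in> V \<Longrightarrow> y * v \<in> emb_span V)
              \<Longrightarrow> (\<And>v. v \<in> V \<Longrightarrow> z * v \<in> emb_span V)"
  shows "integral_elem z"
proof -
  obtain m c where m: "m > 0" "x ^ m = (\<Sum>i<m. emb (c i) * x ^ i)"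
    using integral_elemE[OF assms(1)] by blast
  obtain n d where n: "n > 0" "y ^ n = (\<Sum>i<n. emb (d i) * y ^ i)"
    using integral_elemE[OF assms(2)] by blast
  define V where "V = (\<lambda>(i, j). x ^ i * y ^ j) ` ({..<m} \<times> {..<n})"
  have fin: "finite V"
    by (simp add: V_def)
  have mem: "x ^ i * y ^ j \<in> emb_span V" if "i < m" "j < n" for i j
    using that by (intro emb_span_base[OF fin]) (auto simp: V_def)
  have "x * v \<in> emb_span V" if v: "v \<in> V" for v
  proof -
    obtain i j where ij: "i < m" "j < n" "v = x ^ i * y ^ j"
      using v by (auto simp: V_def)
    show ?thesis
    proof (cases "Suc i < m")
      case True
      then show ?thesis
        using mem[of "Suc i" j] ij by (simp add: mult.assoc)
    next
      case False
      then have "Suc i = m"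
        using ij by simp
      then have "x * v = x ^ m * y ^ j"
        using ij by auto
      also have "\<dots> = (\<Sum>i<m. emb (c i) * (x ^ i * y ^ j))"
        by (simp add: m(2) sum_distrib_right mult.assoc)
      also have "\<dots> \<in> emb_span V"
        using ij by (auto intro!: emb_span_sum emb_span_scale mem)
      finally show ?thesis .
    qed
  qed
  moreover have "y * v \<in> emb_span V" if v: "v \<in> V" for v
  proof -
    obtain i j where ij: "i < m" "j < n" "v = x ^ i * y ^ j"
      using v by (auto simp: V_def)
    show ?thesis
    proof (cases "Suc j < n")
      case True
      then show ?thesis
        using mem[of i "Suc j"] ij by (simp add: mult.left_commute)
    next
      case False
      then have "Suc j = n"
        using ij by simp
      then have "y * v = x ^ i * y ^ n"
        using ij by auto
      also have "\<dots> = (\<Sum>j<n. emb (d j) * (x ^ i * y ^ j))"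
        by (simp add: n(2) sum_distrib_left mult.left_commute)
      also have "\<dots> \<in> emb_span V"
        using ij by (auto intro!: emb_span_sum emb_span_scale mem)
      finally show ?thesis .
    qed
  qed
  moreover have "1 \<in> V"
    unfolding V_def using m(1) n(1) by (auto intro!: image_eqI[of _ _ "(0, 0)"])
  ultimately show ?thesis
    using fin by (intro integral_elem_if_emb_span_stable[of V] z bexI[of _ 1]) auto
qed

lemma integral_elem_add:
  assumes "integral_elem x" "integral_elem y"
  shows "integral_elem (x + y)"
proof (rule integral_elem_if_adjoin[OF assms])
  fix V v
  assume "\<And>v. v \<in> V \<Longrightarrow> x * v \<in> emb_span V" "\<And>v. v \<in> V \<Longrightarrow> y * v \<in> emb_span V" "v \<in> V"
  then show "(x + y) * v \<in> emb_span V"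
    unfolding distrib_right by (intro emb_span_add)
qed

lemma integral_elem_mult:
  assumes "integral_elem x" "integral_elem y"
  shows "integral_elem (x * y)"
proof (rule integral_elem_if_adjoin[OF assms])
  fix V v
  assume x: "\<And>v. v \<in> V \<Longrightarrow> x * v \<in> emb_span V" and "\<And>v. v \<in> V \<Longrightarrow> y * v \<in> emb_span V" "v \<in> V"
  then have "y * v \<in> emb_span V"
    by blast
  then show "x * y * v \<in> emb_span V"
    unfolding mult.assoc by - (rule emb_span_mult_mem, rule x)
qed

lemma integral_elem_emb: "integral_elem (emb r)"
  unfolding integral_elem_def by (intro exI[of _ "[:- r, 1:]"]) (simp add: map_poly_pCons)

lemma integral_elem_0: "integral_elem 0" and integral_elem_1: "integral_elem 1"
  using integral_elem_emb[of 0] integral_elem_emb[of 1] by simp_all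

lemma integral_elem_uminus: "integral_elem x \<Longrightarrow> integral_elem (- x)"
  using integral_elem_mult[OF integral_elem_emb[of "- 1"], of x] by simp

lemma integral_elem_diff: "integral_elem x \<Longrightarrow> integral_elem y \<Longrightarrow> integral_elem (x - y)"
  using integral_elem_add[of x "- y"] integral_elem_uminus[of y] by simp

text \<open>R is integrally closed in K. Multiplying the integral equation of u/v by v^n shows that
  a prime P dividing v divides u^n, hence u; P is cancelled from the fraction and the induction on
  the degree of v continues.\<close>

lemma dvd_if_integral_elem_divide:
  assumes "v \<noteq> 0" "integral_elem (emb u / emb v)"
  shows "v dvd u"
  using assms
proof (induction "Polynomial.degree v" arbitrary: u v rule: less_induct)
  case less
  show ?case
  proof (cases "Polynomial.degree v = 0")
    case True
    then have "is_unit v"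
      using less.prems by (simp add: is_unit_iff_degree)
    then show ?thesis
      by (rule unit_imp_dvd)
  next
    case False
    then obtain P where P: "P \<in> monic_primes" "P dvd v"
      using exists_monic_prime_dvd by blast
    then have irr: "irreducible P"
      by (simp add: monic_primes_def)
    obtain n c where n: "n > 0" "(emb u / emb v) ^ n = (\<Sum>i<n. emb (c i) * (emb u / emb v) ^ i)"
      using integral_elemE[OF less.prems(2)] by blast
    have "emb u ^ n = (emb u / emb v) ^ n * emb v ^ n"
      using less.prems(1) by (simp add: power_divide)
    also have "\<dots> = (\<Sum>i<n. emb (c i) * ((emb u / emb v) ^ i * emb v ^ n))"
      by (simp add: n(2) sum_distrib_right mult.assoc)
    also have "\<dots> = (\<Sum>i<n. emb (v * (c i * u ^ i * v ^ (n - Suc i))))"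
    proof (intro sum.cong refl)
      fix i assume "i \<in> {..<n}"
      \<comment> \<open>As i < n, clearing the denominator v^i from the i-th term leaves at least
        one factor v of v^n.\<close>
      then have "n = i + Suc (n - Suc i)"
        by simp
      then have "emb v ^ n = emb v ^ i * (emb v * emb v ^ (n - Suc i))"
        by (metis power_Suc power_add)
      then show "emb (c i) * ((emb u / emb v) ^ i * emb v ^ n) = emb (v * (c i * u ^ i * v ^ (n - Suc i)))"
        using less.prems(1) by (simp add: power_divide)
    qed
    finally have "emb (u ^ n) = emb (\<Sum>i<n. v * (c i * u ^ i * v ^ (n - Suc i)))"
      by (simp add: emb_sum)
    then have "u ^ n = v * (\<Sum>i<n. c i * u ^ i * v ^ (n - Suc i))"
      unfolding emb_simps(8) by (simp add: sum_distrib_left)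
    then have "P dvd u ^ n"
      using P(2) by simp
    then have "P dvd u"
      by (rule irreducible_dvd_power[OF irr])
    then obtain u' where u': "u = P * u'" ..
    obtain v' where v': "v = P * v'"
      using P(2) ..
    have nz: "P \<noteq> 0" "v' \<noteq> 0"
      using v' less.prems(1) by auto
    have "Polynomial.degree P > 0"
      using irr nz by (auto simp: irreducible_def is_unit_iff_degree)
    then have "Polynomial.degree v' < Polynomial.degree v"
      using nz by (simp add: v' degree_mult_eq)
    moreover have "emb u / emb v = emb u' / emb v'"
      using nz by (simp add: u' v')
    ultimately have "v' dvd u'"
      using less.prems(2) nz(2) by (intro less.hyps) auto
    then show ?thesis
      by (simp add: u' v')
  qed
qed

lemma ratfun_cases:
  obtains u v where "v \<noteq> 0" "k = to_fract u / to_fract v"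
proof -
  obtain u v where "k = Fract u v" "v \<noteq> 0"
    by (cases k) auto
  then show ?thesis
    using that by (metis Fract_conv_to_fract)
qed

lemma integral_elem_to_ac_iff: "integral_elem (to_ac k) \<longleftrightarrow> to_ac k \<in> range emb"
proof
  assume int: "integral_elem (to_ac k)"
  obtain u v where uv: "v \<noteq> 0" "k = to_fract u / to_fract v"
    by (rule ratfun_cases)
  then have eq: "to_ac k = emb u / emb v"
    by (simp add: emb_def)
  then have "v dvd u"
    using dvd_if_integral_elem_divide uv(1) int by metis
  then obtain w where "u = v * w" ..
  then show "to_ac k \<in> range emb"
    using eq uv(1) by simp
next
  assume "to_ac k \<in> range emb"
  then obtain r where "to_ac k = emb r"
    by blast
  then show "integral_elem (to_ac k)"
    by (simp only: integral_elem_emb)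
qed

lemma common_denominator:
  assumes "finite S"
  obtains d where "d \<noteq> 0" "\<And>k. k \<in> S \<Longrightarrow> \<exists>r. to_fract d * k = to_fract r"
proof -
  have "\<exists>d. d \<noteq> 0 \<and> (\<forall>k\<in>S. \<exists>r. to_fract d * k = to_fract r)"
    using assms
  proof (induction S)
    case empty
    then show ?case
      by (intro exI[of _ 1]) simp
  next
    case (insert k S)
    then obtain d where d: "d \<noteq> 0" "\<forall>k\<in>S. \<exists>r. to_fract d * k = to_fract r"
      by blast
    obtain u v where uv: "v \<noteq> 0" "k = to_fract u / to_fract v"
      by (rule ratfun_cases)
    have "to_fract (d * v) * k = to_fract (d * u)"
      using uv by simp
    moreover have "\<exists>r. to_fract (d * v) * k' = to_fract r" if k': "k' \<in> S" for k'
    proof -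
      obtain r where "to_fract d * k' = to_fract r"
        using d(2) k' by blast
      then have "to_fract (d * v) * k' = to_fract (r * v)"
        by (metis mult.assoc mult.commute to_fract_mult)
      then show ?thesis ..
    qed
    ultimately show ?case
      using d(1) uv(1) by (intro exI[of _ "d * v"] conjI) (auto simp del: to_fract_mult)
  qed
  then show ?thesis
    using that by blast
qed

text \<open>The witness is the leading coefficient \<open>q n\<close> of an equation of x over R,
  not the common denominator \<open>d\<close> used to find that equation. Multiplication by
  \<open>q n\<close> x stabilizes the R-span of 1, x, ..., x^(n-1), since \<open>q n\<close> x^n is
  an R-combination of lower powers.\<close>

lemma exists_integral_multiple:
  obtains d where "d \<noteq> 0" "integral_elem (emb d * x)"
proof -
  obtain p where p: "p \<noteq> 0" "poly (map_poly to_ac p) x = 0"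
    by (rule alg_closure_algebraic)
  define n where "n = Polynomial.degree p"
  obtain d where d0: "d \<noteq> 0"
    and d: "\<And>k. k \<in> Polynomial.coeff p ` {..n} \<Longrightarrow> \<exists>r. to_fract d * k = to_fract r"
    using common_denominator[of "Polynomial.coeff p ` {..n}"] by blast
  obtain q where q: "\<And>i. i \<le> n \<Longrightarrow> to_fract d * Polynomial.coeff p i = to_fract (q i)"
  proof -
    have "\<forall>i. \<exists>r. i \<le> n \<longrightarrow> to_fract d * Polynomial.coeff p i = to_fract r"
      using d by blast
    then show ?thesis
      using that by metis
  qed
  have "to_fract d * Polynomial.coeff p n \<noteq> 0"
    using d0 p(1) by (simp add: n_def)
  then have "to_fract (q n) \<noteq> 0"
    unfolding q[OF order.refl] .
  then have qn: "q n \<noteq> 0"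
    by auto
  have "Polynomial.degree (map_poly to_ac p) = n"
    unfolding n_def by (rule degree_map_poly) simp
  then have "(\<Sum>i\<le>n. to_ac (Polynomial.coeff p i) * x ^ i) = 0"
    using p(2) by (simp add: poly_altdef coeff_map_poly)
  then have "emb d * (\<Sum>i\<le>n. to_ac (Polynomial.coeff p i) * x ^ i) = 0"
    by simp
  also have "emb d * (\<Sum>i\<le>n. to_ac (Polynomial.coeff p i) * x ^ i)
      = (\<Sum>i\<le>n. to_ac (to_fract d * Polynomial.coeff p i) * x ^ i)"
    by (simp add: emb_def sum_distrib_left mult.assoc)
  also have "\<dots> = (\<Sum>i\<le>n. emb (q i) * x ^ i)"
    by (intro sum.cong refl) (simp only: emb_def q atMost_iff)
  finally have "(\<Sum>i<n. emb (q i) * x ^ i) + emb (q n) * x ^ n = 0"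
    by (simp flip: lessThan_Suc_atMost)
  then have eq: "emb (q n) * x ^ n = - (\<Sum>i<n. emb (q i) * x ^ i)"
    by (simp add: add_eq_0_iff2)
  then have n: "n > 0"
    using qn by (cases n) auto
  define V where "V = (\<lambda>i. x ^ i) ` {..<n}"
  have fin: "finite V"
    by (simp add: V_def)
  have mem: "x ^ i \<in> emb_span V" if "i < n" for i
    using that by (intro emb_span_base[OF fin]) (auto simp: V_def)
  have "integral_elem (emb (q n) * x)"
  proof (rule integral_elem_if_emb_span_stable[OF fin])
    have "1 \<in> V"
      unfolding V_def using n by (auto intro!: image_eqI[of _ _ 0])
    then show "\<exists>v\<in>V. v \<noteq> 0"
      by (intro bexI[of _ 1]) auto
  next
    fix v assume "v \<in> V"
    then obtain i where i: "i < n" "v = x ^ i"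
      by (auto simp: V_def)
    show "emb (q n) * x * v \<in> emb_span V"
    proof (cases "Suc i < n")
      case True
      then show ?thesis
        using emb_span_scale[OF mem[OF True], of "q n"] i by (simp add: mult.assoc)
    next
      case False
      then have "Suc i = n"
        using i by simp
      then have "emb (q n) * x * v = emb (q n) * x ^ n"
        using i by (auto simp: mult.assoc)
      also have "\<dots> \<in> emb_span V"
        unfolding eq by (intro emb_span_uminus emb_span_sum emb_span_scale mem) simp
      finally show ?thesis .
    qed
  qed
  with qn show ?thesis
    by (rule that)
qed

section \<open>Galois invariants, finiteness of \<Gamma> and primitive elements\<close>

subsection \<open>The Galois group\<close>

lemma ring_of_type_algebra_simps [simp]:
  "carrier ring_of_type_algebra = UNIV"
  "x \<otimes>\<^bsub>ring_of_type_algebra\<^esub> y = x * y" "\<one>\<^bsub>ring_of_type_algebra\<^esub> = 1"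
  "x \<oplus>\<^bsub>ring_of_type_algebra\<^esub> y = x + y" "\<zero>\<^bsub>ring_of_type_algebra\<^esub> = 0"
  by (simp_all add: ring_of_type_algebra_def)

lemma a_inv_ring_of_type_algebra [simp]: "\<ominus>\<^bsub>ring_of_type_algebra\<^esub> x = - (x :: 'a::comm_ring_1)"
proof -
  interpret ring "ring_of_type_algebra :: 'a ring"
    by (rule ring_from_type_algebra)
  show ?thesis
    using minus_equality[of "- x" x] by simp
qed

locale galois_ext =
  fixes L :: "'a::{field, finite} ratfun_bar set"
  assumes finite_galois: "finite_galois L"
begin

abbreviation \<Gamma> :: "('a ratfun_bar \<Rightarrow> 'a ratfun_bar) set"
  where "\<Gamma> \<equiv> carrier (galois_group L)"

lemma subring_L: "subring L ring_of_type_algebra"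
  using finite_galois unfolding finite_galois_def
  by (blast intro: subcring.axioms(1) subdomain.axioms(1) subfield.axioms(1))

lemma L_closed [simp, intro]:
  "0 \<in> L" "1 \<in> L"
  "x \<in> L \<Longrightarrow> y \<in> L \<Longrightarrow> x + y \<in> L"
  "x \<in> L \<Longrightarrow> y \<in> L \<Longrightarrow> x * y \<in> L"
  "x \<in> L \<Longrightarrow> - x \<in> L"
  using subringE[OF subring_L] by simp_all

lemma to_ac_in_L [simp, intro]: "to_ac k \<in> L"
  using finite_galois unfolding finite_galois_def by blast

lemma emb_in_L [simp, intro]: "emb r \<in> L"
  by (simp add: emb_def)

lemma L_diff [simp, intro]: "x \<in> L \<Longrightarrow> y \<in> L \<Longrightarrow> x - y \<in> L"
  using L_closed(3)[of x "- y"] by simp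

lemma L_power [simp, intro]: "x \<in> L \<Longrightarrow> x ^ n \<in> L"
  by (induction n) auto

lemma L_sum [intro]: "(\<And>a. a \<in> A \<Longrightarrow> f a \<in> L) \<Longrightarrow> sum f A \<in> L"
  by (induction A rule: infinite_finite_induct) auto

lemma L_prod [intro]: "(\<And>a. a \<in> A \<Longrightarrow> f a \<in> L) \<Longrightarrow> prod f A \<in> L"
  by (induction A rule: infinite_finite_induct) auto

lemma mem_galois_group_iff:
  "\<sigma> \<in> \<Gamma> \<longleftrightarrow> \<sigma> \<in> Bij L \<and> (\<forall>x\<in>L. \<forall>y\<in>L. \<sigma> (x + y) = \<sigma> x + \<sigma> y \<and> \<sigma> (x * y) = \<sigma> x * \<sigma> y) \<and>
     (\<forall>k. \<sigma> (to_ac k) = to_ac k)"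
proof -
  have "\<sigma> 1 = 1" if "\<forall>k. \<sigma> (to_ac k) = to_ac k"
    using that to_ac_1 by metis
  then show ?thesis
    using Bij_imp_funcset[of \<sigma> L]
    by (auto simp: galois_group_def Ring.ring_hom_def Pi_iff)
qed

lemma galois_closed: "\<sigma> \<in> \<Gamma> \<Longrightarrow> x \<in> L \<Longrightarrow> \<sigma> x \<in> L"
  using mem_galois_group_iff Bij_imp_funcset by blast

lemma galois_Bij: "\<sigma> \<in> \<Gamma> \<Longrightarrow> \<sigma> \<in> Bij L"
  using mem_galois_group_iff by blast

lemma galois_add: "\<sigma> \<in> \<Gamma> \<Longrightarrow> x \<in> L \<Longrightarrow> y \<in> L \<Longrightarrow> \<sigma> (x + y) = \<sigma> x + \<sigma> y"
  and galois_mult: "\<sigma> \<in> \<Gamma> \<Longrightarrow> x \<in> L \<Longrightarrow> y \<in> L \<Longrightarrow> \<sigma> (x * y) = \<sigma> x * \<sigma> y"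
  and galois_to_ac: "\<sigma> \<in> \<Gamma> \<Longrightarrow> \<sigma> (to_ac k) = to_ac k"
  using mem_galois_group_iff by blast+

lemma galois_emb: "\<sigma> \<in> \<Gamma> \<Longrightarrow> \<sigma> (emb r) = emb r"
  by (simp add: emb_def galois_to_ac)

lemma galois_0_1: "\<sigma> \<in> \<Gamma> \<Longrightarrow> \<sigma> 0 = 0" "\<sigma> \<in> \<Gamma> \<Longrightarrow> \<sigma> 1 = 1"
  using galois_emb[of \<sigma> 0] galois_emb[of \<sigma> 1] by simp_all

lemma galois_uminus: "\<sigma> \<in> \<Gamma> \<Longrightarrow> x \<in> L \<Longrightarrow> \<sigma> (- x) = - \<sigma> x"
  using galois_add[of \<sigma> x "- x"] by (simp add: add_eq_0_iff galois_0_1)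

lemma galois_diff: "\<sigma> \<in> \<Gamma> \<Longrightarrow> x \<in> L \<Longrightarrow> y \<in> L \<Longrightarrow> \<sigma> (x - y) = \<sigma> x - \<sigma> y"
  using galois_add[of \<sigma> x "- y"] by (simp add: galois_uminus)

lemma galois_power: "\<sigma> \<in> \<Gamma> \<Longrightarrow> x \<in> L \<Longrightarrow> \<sigma> (x ^ n) = \<sigma> x ^ n"
  by (induction n) (auto simp: galois_0_1 galois_mult)

lemma galois_sum:
  "\<sigma> \<in> \<Gamma> \<Longrightarrow> (\<And>a. a \<in> A \<Longrightarrow> f a \<in> L) \<Longrightarrow> \<sigma> (sum f A) = (\<Sum>a\<in>A. \<sigma> (f a))"
  by (induction A rule: infinite_finite_induct) (auto simp: L_sum galois_0_1 galois_add)

lemma galois_prod: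
  "\<sigma> \<in> \<Gamma> \<Longrightarrow> (\<And>a. a \<in> A \<Longrightarrow> f a \<in> L) \<Longrightarrow> \<sigma> (prod f A) = (\<Prod>a\<in>A. \<sigma> (f a))"
  by (induction A rule: infinite_finite_induct) (auto simp: L_prod galois_0_1 galois_mult)

lemmas galois_simps =
  galois_closed galois_add galois_mult galois_to_ac galois_emb galois_0_1 galois_uminus galois_diff galois_power

lemma galois_eqI:
  assumes "\<sigma> \<in> \<Gamma>" "\<tau> \<in> \<Gamma>" "\<And>x. x \<in> L \<Longrightarrow> \<sigma> x = \<tau> x"
  shows "\<sigma> = \<tau>"
proof (rule extensionalityI[of _ L])
  show "\<sigma> \<in> extensional L" "\<tau> \<in> extensional L"
    using assms(1,2) by (simp_all add: galois_Bij Bij_imp_extensional)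
qed (rule assms(3))

lemma galois_id: "(\<lambda>x\<in>L. x) \<in> \<Gamma>"
  unfolding mem_galois_group_iff by (auto simp: id_Bij)

lemma one_galois_group: "\<one>\<^bsub>galois_group L\<^esub> = (\<lambda>x\<in>L. x)"
  by (simp add: galois_group_def BijGroup_def)

lemma mult_galois_group:
  assumes "\<sigma> \<in> \<Gamma>" "\<tau> \<in> \<Gamma>"
  shows "\<sigma> \<otimes>\<^bsub>galois_group L\<^esub> \<tau> = compose L \<sigma> \<tau>"
  using galois_Bij[OF assms(1)] galois_Bij[OF assms(2)] by (simp add: galois_group_def BijGroup_def)

lemma group_galois_group: "group (galois_group L)"
proof -
  have carr: "BijGroup L\<lparr>carrier := \<Gamma>\<rparr> = galois_group L"
    by (simp add: galois_group_def)
  have "subgroup \<Gamma> (BijGroup L)"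
  proof (rule group.subgroupI[OF group_BijGroup])
    show "\<Gamma> \<subseteq> carrier (BijGroup L)"
      using galois_Bij by (auto simp: BijGroup_def)
    show "\<Gamma> \<noteq> {}"
      using galois_id by blast
  next
    fix \<sigma> assume s: "\<sigma> \<in> \<Gamma>"
    then have bij: "\<sigma> \<in> Bij L"
      by (rule galois_Bij)
    have "inv_into L \<sigma> (to_ac k) = to_ac k" for k
      using s bij inv_into_f_f[of \<sigma> L "to_ac k"] by (simp add: Bij_def bij_betw_def galois_to_ac)
    moreover have "inv_into L \<sigma> (x + y) = inv_into L \<sigma> x + inv_into L \<sigma> y"
      "inv_into L \<sigma> (x * y) = inv_into L \<sigma> x * inv_into L \<sigma> y" if "x \<in> L" "y \<in> L" for x y
      using that s by (intro Bij_inv_into_lemma[OF _ bij]; auto simp: galois_add galois_mult)+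
    ultimately show "inv\<^bsub>BijGroup L\<^esub> \<sigma> \<in> \<Gamma>"
      unfolding mem_galois_group_iff inv_BijGroup[OF bij] using restrict_inv_into_Bij[OF bij] by simp
  next
    fix \<sigma> \<tau> assume st: "\<sigma> \<in> \<Gamma>" "\<tau> \<in> \<Gamma>"
    then have bij: "\<sigma> \<in> Bij L" "\<tau> \<in> Bij L"
      by (simp_all add: galois_Bij)
    then have "compose L \<sigma> \<tau> \<in> \<Gamma>"
      using st unfolding mem_galois_group_iff[of "compose L \<sigma> \<tau>"]
      by (simp add: compose_Bij compose_eq galois_simps)
    then show "\<sigma> \<otimes>\<^bsub>BijGroup L\<^esub> \<tau> \<in> \<Gamma>"
      using bij by (simp add: BijGroup_def)
  qed
  then show ?thesis
    using group.subgroup_imp_group[OF group_BijGroup] carr by metis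
qed

lemma galois_compose: "\<sigma> \<in> \<Gamma> \<Longrightarrow> \<tau> \<in> \<Gamma> \<Longrightarrow> compose L \<sigma> \<tau> \<in> \<Gamma>"
  using monoid.m_closed[OF group.is_monoid[OF group_galois_group]] mult_galois_group by metis

text \<open>Reindexing along this left translation yields the Galois invariance of norms, of the
  sums \<open>interpol\<close> and of the coefficients of the conjugates polynomial.\<close>

lemma bij_betw_galois_compose:
  assumes "\<rho> \<in> \<Gamma>"
  shows "bij_betw (compose L \<rho>) \<Gamma> \<Gamma>"
proof -
  have *: "\<rho> \<otimes>\<^bsub>galois_group L\<^esub> \<sigma> = compose L \<rho> \<sigma>" if "\<sigma> \<in> \<Gamma>" for \<sigma>
    using mult_galois_group[OF assms that] .
  have "bij_betw (\<lambda>\<sigma>. \<rho> \<otimes>\<^bsub>galois_group L\<^esub> \<sigma>) \<Gamma> \<Gamma>"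
    unfolding bij_betw_def
    using group.inj_on_cmult[OF group_galois_group assms] group.surj_const_mult[OF group_galois_group assms]
    by blast
  then show ?thesis
    using bij_betw_cong[of \<Gamma> _ "compose L \<rho>"] * by blast
qed

lemma fixed_in_range_to_ac:
  assumes "x \<in> L" "\<And>\<sigma>. \<sigma> \<in> \<Gamma> \<Longrightarrow> \<sigma> x = x"
  shows "x \<in> range to_ac"
  using finite_galois assms unfolding finite_galois_def by blast

lemma fixed_integral_in_range_emb:
  assumes "x \<in> L" "\<And>\<sigma>. \<sigma> \<in> \<Gamma> \<Longrightarrow> \<sigma> x = x" "integral_elem x"
  shows "x \<in> range emb"
proof -
  have "x \<in> range to_ac"
    using assms(1,2) by (rule fixed_in_range_to_ac)
  then show ?thesis
    using assms(3) integral_elem_to_ac_iff by blast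
qed

lemma galois_integral:
  assumes "\<sigma> \<in> \<Gamma>" "x \<in> L" "integral_elem x"
  shows "integral_elem (\<sigma> x)"
proof -
  obtain p where p: "Polynomial.lead_coeff p = 1" "poly (map_poly emb p) x = 0"
    using assms by (auto simp: integral_elem_def)
  have "poly (map_poly emb p) (\<sigma> x) = \<sigma> (poly (map_poly emb p) x)"
    using assms by (simp add: poly_map_poly_emb galois_sum galois_simps)
  then show ?thesis
    using p assms(1) by (auto simp: integral_elem_def galois_0_1)
qed

text \<open>Spanning over K is expressed by minimality among subspaces S instead of by linear
  combinations. It is applied with S the set on which two automorphisms agree.\<close>

definition generates :: "'a ratfun_bar list \<Rightarrow> 'a ratfun_bar set \<Rightarrow> bool"
  where "generates us E \<longleftrightarrow> set us \<subseteq> E \<and> 0 \<in> E \<and>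
    (\<forall>S. 0 \<in> S \<longrightarrow> set us \<subseteq> S \<longrightarrow> (\<forall>x\<in>S. \<forall>y\<in>S. x + y \<in> S) \<longrightarrow>
      (\<forall>k. \<forall>x\<in>S. to_ac k * x \<in> S) \<longrightarrow> E \<subseteq> S)"

text \<open>Finite dimension is given inductively through \<open>line_extension\<close>; the vectors
  adjoined along the way form the list.\<close>

lemma exists_generators:
  obtains us where "generates us L"
proof -
  interpret ring "ring_of_type_algebra :: 'a ratfun_bar ring"
    by (rule ring_from_type_algebra)
  have gen: "\<exists>us. generates us E"
    if "dimension n (range to_ac) E" for n E
    using that
  proof (induction n "range to_ac :: 'a ratfun_bar set" E rule: dimension.induct)
    case zero_dim
    show ?case
      by (intro exI[of _ "[]"]) (auto simp: generates_def)
  next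
    case (Suc_dim v E n)
    then obtain us where gen: "generates us E"
      by blast
    then have us: "set us \<subseteq> E" "0 \<in> E"
      by (auto simp: generates_def)
    have mem: "to_ac k * v + e \<in> line_extension (range to_ac) v E" if "e \<in> E" for k e
      using that by (auto simp: line_extension_mem_iff)
    have "v \<in> line_extension (range to_ac) v E"
      using mem[OF us(2), of 1] by simp
    moreover have "E \<subseteq> line_extension (range to_ac) v E"
      using mem[of _ 0] by auto
    moreover have "line_extension (range to_ac) v E \<subseteq> S"
      if S: "0 \<in> S" "set (v # us) \<subseteq> S" "\<forall>x\<in>S. \<forall>y\<in>S. x + y \<in> S"
        "\<forall>k. \<forall>x\<in>S. to_ac k * x \<in> S" for S
    proof
      fix x assume "x \<in> line_extension (range to_ac) v E"
      then obtain k e where "x = to_ac k * v + e" "e \<in> E"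
        by (auto simp: line_extension_mem_iff)
      moreover have "E \<subseteq> S"
        using S gen by (simp add: generates_def)
      ultimately show "x \<in> S"
        using S(2,3,4) by auto
    qed
    ultimately show ?case
      using us unfolding generates_def by (intro exI[of _ "v # us"] conjI allI impI) auto
  qed
  have "finite_dimension (range to_ac) L"
    using finite_galois by (simp add: finite_galois_def)
  then obtain n where "dimension n (range to_ac) L"
    by (rule finite_dimensionE')
  from gen[OF this] show ?thesis
    using that by blast
qed

lemma galois_eq_on_generators:
  assumes "\<sigma> \<in> \<Gamma>" "\<tau> \<in> \<Gamma>" "\<And>u. u \<in> set us \<Longrightarrow> \<sigma> u = \<tau> u"
    and gen: "generates us L"
  shows "\<sigma> = \<tau>"
proof (rule galois_eqI[OF assms(1,2)])
  fix x assume "x \<in> L"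
  moreover have "set us \<subseteq> {x \<in> L. \<sigma> x = \<tau> x}"
    using assms(3) gen by (auto simp: generates_def)
  then have "L \<subseteq> {x \<in> L. \<sigma> x = \<tau> x}"
    using gen[unfolded generates_def, THEN conjunct2, THEN conjunct2, THEN spec, of "{x \<in> L. \<sigma> x = \<tau> x}"]
      assms(1,2) by (simp add: galois_simps)
  ultimately show "\<sigma> x = \<tau> x"
    by blast
qed

text \<open>An automorphism is determined by its values on the generators, and each value is a root
  of a fixed nonzero polynomial over K.\<close>

lemma finite_galois_group: "finite \<Gamma>"
proof -
  obtain us where gen: "generates us L"
    by (rule exists_generators)
  then have us: "set us \<subseteq> L"
    by (simp add: generates_def)
  have "\<exists>p. p \<noteq> 0 \<and> poly (map_poly to_ac p) u = 0" for u :: "'a ratfun_bar"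
    using alg_closure_algebraic by metis
  then obtain p where p: "\<And>u :: 'a ratfun_bar. p u \<noteq> 0"
    "\<And>u :: 'a ratfun_bar. poly (map_poly to_ac (p u)) u = 0"
    by metis
  define Z where "Z = (\<Union>u\<in>set us. {x. poly (map_poly to_ac (p u)) x = 0})"
  have "finite Z"
    unfolding Z_def
  proof (intro finite_UN_I poly_roots_finite)
    fix u
    have "Polynomial.coeff (map_poly to_ac (p u)) (Polynomial.degree (p u)) \<noteq> 0"
      using p(1)[of u] by (simp add: coeff_map_poly)
    then show "map_poly to_ac (p u) \<noteq> 0"
      by auto
  qed simp
  have "\<sigma> u \<in> Z" if "\<sigma> \<in> \<Gamma>" "u \<in> set us" for \<sigma> u
  proof -
    have "u \<in> L"
      using that us by blast
    then have "poly (map_poly to_ac (p u)) (\<sigma> u) = \<sigma> (poly (map_poly to_ac (p u)) u)"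
      using that(1) by (simp add: poly_altdef coeff_map_poly galois_sum galois_simps)
    then have "poly (map_poly to_ac (p u)) (\<sigma> u) = 0"
      using that(1) p(2) by (simp add: galois_0_1)
    then show ?thesis
      unfolding Z_def using that(2) by blast
  qed
  then have sub: "(\<lambda>\<sigma>. map \<sigma> us) ` \<Gamma> \<subseteq> {xs. set xs \<subseteq> Z \<and> length xs = length us}"
    by auto
  have "inj_on (\<lambda>\<sigma>. map \<sigma> us) \<Gamma>"
  proof (rule inj_onI)
    fix \<sigma> \<tau> assume "\<sigma> \<in> \<Gamma>" "\<tau> \<in> \<Gamma>" "map \<sigma> us = map \<tau> us"
    then show "\<sigma> = \<tau>"
      using gen by (intro galois_eq_on_generators[of \<sigma> \<tau> us]) auto
  qed
  then show ?thesis
    using finite_subset[OF sub finite_lists_length_eq[OF \<open>finite Z\<close>]] finite_imageD by blast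
qed

text \<open>A primitive element \<open>\<Sum>\<^sub>i c\<^sup>i u\<^sub>i\<close>: the bad \<open>c\<close> are roots of finitely many nonzero polynomials.\<close>

lemma exists_integral_primitive_element:
  obtains \<beta> where "\<beta> \<in> L" "integral_elem \<beta>"
    "\<And>\<sigma> \<tau>. \<sigma> \<in> \<Gamma> \<Longrightarrow> \<tau> \<in> \<Gamma> \<Longrightarrow> \<sigma> \<beta> = \<tau> \<beta> \<Longrightarrow> \<sigma> = \<tau>"
proof -
  obtain us where gen: "generates us L"
    by (rule exists_generators)
  then have us: "set us \<subseteq> L"
    by (simp add: generates_def)
  \<comment> \<open>The value of this polynomial at c is \<sigma>(\<beta>) - \<tau>(\<beta>) for
    \<beta> the sum of the c^i u_i. It is nonzero for \<sigma> different from \<tau> because the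
    generators separate automorphisms.\<close>
  define D where "D \<sigma> \<tau> = Poly (map (\<lambda>u. \<sigma> u - \<tau> u) us)"
    for \<sigma> \<tau> :: "'a ratfun_bar \<Rightarrow> 'a ratfun_bar"
  have D0: "D \<sigma> \<tau> \<noteq> 0" if st: "\<sigma> \<in> \<Gamma>" "\<tau> \<in> \<Gamma>" "\<sigma> \<noteq> \<tau>" for \<sigma> \<tau>
  proof
    assume "D \<sigma> \<tau> = 0"
    then have "\<forall>u\<in>set us. \<sigma> u - \<tau> u = 0"
      unfolding D_def Poly_eq_0
      by (metis (no_types, lifting) in_set_replicate list.set_map imageI)
    then have "\<sigma> = \<tau>"
      using st gen by (intro galois_eq_on_generators[of \<sigma> \<tau> us]) auto
    with st show False
      by blast
  qed
  define Bad where "Bad = (\<Union>(\<sigma>, \<tau>)\<in>{(\<sigma>, \<tau>). \<sigma> \<in> \<Gamma> \<and> \<tau> \<in> \<Gamma> \<and> \<sigma> \<noteq> \<tau>}. {x. poly (D \<sigma> \<tau>) x = 0})"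
  have "finite {(\<sigma>, \<tau>). \<sigma> \<in> \<Gamma> \<and> \<tau> \<in> \<Gamma> \<and> \<sigma> \<noteq> \<tau>}"
    by (rule finite_subset[of _ "\<Gamma> \<times> \<Gamma>"]) (auto simp: finite_galois_group)
  then have "finite Bad"
    unfolding Bad_def using D0 by (intro finite_UN_I) (auto intro: poly_roots_finite)
  \<comment> \<open>The parameter c is sought in R: this ring is infinite and fixed by \<Gamma>, so
    every \<sigma> can be moved inside the sum defining \<beta>.\<close>
  moreover have "infinite (range (emb :: 'a poly \<Rightarrow> _))"
    using infinite_UNIV_poly by (auto dest: finite_imageD simp: inj_def)
  ultimately obtain c where c: "emb c \<notin> Bad"
    by (meson finite_subset image_subsetI)
  define \<beta> where "\<beta> = poly (Poly us) (emb c)"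
  have poly_L: "poly (Poly vs) (emb c) \<in> L" if "set vs \<subseteq> L" for vs
    using that by (induction vs) auto
  have \<beta>: "\<beta> \<in> L"
    unfolding \<beta>_def using us by (rule poly_L)
  have "\<sigma> (poly (Poly vs) (emb c)) - \<tau> (poly (Poly vs) (emb c)) = poly (Poly (map (\<lambda>u. \<sigma> u - \<tau> u) vs)) (emb c)"
    if "\<sigma> \<in> \<Gamma>" "\<tau> \<in> \<Gamma>" "set vs \<subseteq> L" for \<sigma> \<tau> vs
    using that(3)
  proof (induction vs)
    case (Cons v vs)
    then show ?case
      using that(1,2) poly_L[of vs] by (simp add: galois_simps algebra_simps flip: Cons.IH)
  qed (use that(1,2) in \<open>simp add: galois_0_1\<close>)
  then have diff: "\<sigma> \<beta> - \<tau> \<beta> = poly (D \<sigma> \<tau>) (emb c)" if "\<sigma> \<in> \<Gamma>" "\<tau> \<in> \<Gamma>" for \<sigma> \<tau>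
    unfolding D_def \<beta>_def using that us by blast
  \<comment> \<open>Scaling by a nonzero d in R makes \<beta> integral and keeps its conjugates
    distinct.\<close>
  obtain d where d: "d \<noteq> 0" "integral_elem (emb d * \<beta>)"
    by (rule exists_integral_multiple)
  show ?thesis
  proof (rule that)
    show "emb d * \<beta> \<in> L" "integral_elem (emb d * \<beta>)"
      using d \<beta> by auto
    fix \<sigma> \<tau> assume st: "\<sigma> \<in> \<Gamma>" "\<tau> \<in> \<Gamma>" "\<sigma> (emb d * \<beta>) = \<tau> (emb d * \<beta>)"
    then have "\<sigma> \<beta> - \<tau> \<beta> = 0"
      using d(1) \<beta> by (simp add: galois_mult galois_emb)
    then have "poly (D \<sigma> \<tau>) (emb c) = 0"
      using diff st by simp
    then show "\<sigma> = \<tau>"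
      using c st unfolding Bad_def by blast
  qed
qed

end

section \<open>Existence of primes of R_L over P and arithmetic modulo them\<close>

subsection \<open>Primes of the integral closure\<close>

lemma mem_prime_ideal_of_iff: "r \<in> prime_ideal_of P \<longleftrightarrow> P dvd r"
  unfolding prime_ideal_of_def cgenideal_def by (auto simp: dvd_def mult.commute)

text \<open>Krull's theorem: Zorn's lemma gives a maximal element among the proper ideals containing
  a. It is a maximal ideal, hence prime.\<close>

lemma (in cring) exists_prime_ideal_containing:
  assumes a: "a \<in> carrier R" and unit: "\<one> \<notin> PIdl a"
  obtains I where "primeideal I R" "a \<in> I"
proof -
  define A where "A = {I. ideal I R \<and> a \<in> I \<and> \<one> \<notin> I}"
  have "PIdl a \<in> A"
    unfolding A_def using cgenideal_ideal[OF a] cgenideal_self[OF a] unit by blast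
  have "\<exists>M\<in>A. \<forall>J\<in>A. M \<subseteq> J \<longrightarrow> J = M"
  proof (rule subset_Zorn_nonempty)
    show "A \<noteq> {}"
      using \<open>PIdl a \<in> A\<close> by blast
  next
    fix \<C> assume ne: "\<C> \<noteq> {}" and chain: "subset.chain A \<C>"
    then have "subset.chain {I. ideal I R} \<C>"
      unfolding A_def subset.chain_def by blast
    then have "ideal (\<Union>\<C>) R"
      using chain_Union_is_ideal ne by presburger
    moreover have "a \<in> \<Union>\<C>" "\<one> \<notin> \<Union>\<C>"
      using ne chain unfolding A_def subset.chain_def by blast+
    ultimately show "\<Union>\<C> \<in> A"
      unfolding A_def by blast
  qed
  then obtain M where M: "M \<in> A" and max: "\<And>J. J \<in> A \<Longrightarrow> M \<subseteq> J \<Longrightarrow> J = M"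
    by blast
  have id: "ideal M R" "a \<in> M" "\<one> \<notin> M"
    using M unfolding A_def by blast+
  have "maximalideal M R"
  proof (rule maximalidealI[OF id(1)])
    show "carrier R \<noteq> M"
      using id(3) one_closed by blast
  next
    fix J assume J: "ideal J R" "M \<subseteq> J" "J \<subseteq> carrier R"
    show "J = M \<or> J = carrier R"
    proof (cases "\<one> \<in> J")
      case True
      then show ?thesis
        using ideal.one_imp_carrier[OF J(1)] by blast
    next
      case False
      then have "J \<in> A"
        unfolding A_def using J id by blast
      then show ?thesis
        using max J(2) by blast
    qed
  qed
  then show ?thesis
    using that maximalideal_prime id(2) by blast
qed

context galois_ext
begin

abbreviation B :: "'a ratfun_bar set"
  where "B \<equiv> integral_closure_in L"

lemma mem_B_iff: "x \<in> B \<longleftrightarrow> x \<in> L \<and> integral_elem x"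
  by (simp add: integral_closure_in_eq)

lemma B_closed [simp, intro]:
  "0 \<in> B" "1 \<in> B" "emb r \<in> B"
  "x \<in> B \<Longrightarrow> y \<in> B \<Longrightarrow> x + y \<in> B"
  "x \<in> B \<Longrightarrow> y \<in> B \<Longrightarrow> x * y \<in> B"
  "x \<in> B \<Longrightarrow> - x \<in> B"
  "x \<in> B \<Longrightarrow> y \<in> B \<Longrightarrow> x - y \<in> B"
  by (simp_all add: mem_B_iff integral_elem_0 integral_elem_1 integral_elem_emb integral_elem_add
      integral_elem_mult integral_elem_uminus integral_elem_diff)

lemma B_in_L: "x \<in> B \<Longrightarrow> x \<in> L"
  by (simp add: mem_B_iff)

lemma B_power [simp, intro]: "x \<in> B \<Longrightarrow> x ^ n \<in> B"
  by (induction n) auto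

lemma B_sum [intro]: "(\<And>a. a \<in> A \<Longrightarrow> f a \<in> B) \<Longrightarrow> sum f A \<in> B"
  by (induction A rule: infinite_finite_induct) auto

lemma B_prod [intro]: "(\<And>a. a \<in> A \<Longrightarrow> f a \<in> B) \<Longrightarrow> prod f A \<in> B"
  by (induction A rule: infinite_finite_induct) auto

lemma galois_B: "\<sigma> \<in> \<Gamma> \<Longrightarrow> x \<in> B \<Longrightarrow> \<sigma> x \<in> B"
  by (simp add: mem_B_iff galois_closed galois_integral)

lemma fixed_B_in_range_emb:
  assumes "x \<in> B" "\<And>\<sigma>. \<sigma> \<in> \<Gamma> \<Longrightarrow> \<sigma> x = x"
  shows "x \<in> range emb"
  using assms fixed_integral_in_range_emb[of x] by (simp add: mem_B_iff)

lemma cring_integral_closure: "cring (integral_closure_ring L)"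
proof -
  interpret cring "ring_of_type_algebra :: 'a ratfun_bar ring"
    by (rule cring_from_type_algebra)
  have "subring B ring_of_type_algebra"
    by (rule subringI) auto
  then show ?thesis
    using subcring_iff subcringI' by auto
qed

text \<open>P is no unit of R_L, since 1/P is not integral, so some prime ideal \<pp> contains P. It
  contracts exactly to (P), because an element of R prime to P is invertible modulo P and would put
  1 into \<pp>. The result keeps the quantifier over \<pp> in \<open>frobenius_value\<close> from
  being vacuous.\<close>

lemma primes_over_nonempty:
  assumes "P \<in> monic_primes"
  shows "primes_over L P \<noteq> {}"
proof -
  have irr: "irreducible P"
    using assms by (simp add: monic_primes_def)
  then have P0: "P \<noteq> 0"
    by auto
  interpret B: cring "integral_closure_ring L"
    by (rule cring_integral_closure)
  have "\<one>\<^bsub>integral_closure_ring L\<^esub> \<notin> PIdl\<^bsub>integral_closure_ring L\<^esub> (emb P)"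
  proof
    assume "\<one>\<^bsub>integral_closure_ring L\<^esub> \<in> PIdl\<^bsub>integral_closure_ring L\<^esub> (emb P)"
    then obtain x where x: "x \<in> B" "1 = x * emb P"
      by (auto simp: cgenideal_def)
    then have "x = emb 1 / emb P"
      using P0 by (simp add: field_simps)
    then have "P dvd 1"
      using dvd_if_integral_elem_divide[OF P0, of 1] x(1) by (simp add: mem_B_iff)
    then show False
      using irr by (simp add: irreducible_def)
  qed
  then obtain \<pp> where \<pp>: "primeideal \<pp> (integral_closure_ring L)" "emb P \<in> \<pp>"
    using B.exists_prime_ideal_containing[of "emb P"] by auto
  interpret \<pp>: primeideal \<pp> "integral_closure_ring L"
    by (rule \<pp>(1))
  have mult: "emb r * x \<in> \<pp>" if "x \<in> \<pp>" for r x
    using \<pp>.I_l_closed[OF that, of "emb r"] by simp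
  have one: "1 \<notin> \<pp>"
    using \<pp>.one_imp_carrier \<pp>.I_notcarr by auto
  have emb_iff: "emb r \<in> \<pp> \<longleftrightarrow> P dvd r" for r
  proof
    assume "P dvd r"
    then obtain s where "r = P * s" ..
    then show "emb r \<in> \<pp>"
      using mult[OF \<pp>(2), of s] by (simp add: mult.commute)
  next
    assume r: "emb r \<in> \<pp>"
    show "P dvd r"
    proof (rule ccontr)
      assume "\<not> P dvd r"
      then obtain w where "P dvd r * w - 1"
        using irreducible_inverse_mod[OF irr] by blast
      then obtain s where s: "r * w - 1 = P * s" ..
      \<comment> \<open>A Bezout combination of P and r equal to 1.\<close>
      have "emb (- s) * emb P + emb w * emb r \<in> \<pp>"
        using \<pp>.a_closed[OF mult[OF \<pp>(2), of "- s"] mult[OF r, of w]] by (simp del: emb_simps)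
      moreover have "emb (- s) * emb P + emb w * emb r = emb (r * w - P * s)"
        by (simp add: algebra_simps)
      moreover have "r * w - P * s = 1"
        using s by (simp add: algebra_simps)
      ultimately show False
        using one by simp
    qed
  qed
  have "{r. poly_to_bar r \<in> \<pp>} = prime_ideal_of P"
    unfolding poly_to_bar_eq_emb emb_iff using mem_prime_ideal_of_iff by blast
  then show ?thesis
    using \<pp>(1) unfolding primes_over_def by blast
qed

end

locale prime_over = galois_ext L for L :: "'a::{field, finite} ratfun_bar set" +
  fixes P :: "'a poly" and \<pp> :: "'a ratfun_bar set"
  assumes P_prime: "P \<in> monic_primes" and \<pp>_over: "\<pp> \<in> primes_over L P"
begin

lemma irreducible_P: "irreducible P"
  using P_prime by (simp add: monic_primes_def)

lemma primeideal_\<pp>: "primeideal \<pp> (integral_closure_ring L)"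
  using \<pp>_over by (simp add: primes_over_def)

lemma \<pp>_add: "x \<in> \<pp> \<Longrightarrow> y \<in> \<pp> \<Longrightarrow> x + y \<in> \<pp>"
  and \<pp>_mult: "x \<in> B \<Longrightarrow> y \<in> \<pp> \<Longrightarrow> x * y \<in> \<pp>"
  and \<pp>_0: "0 \<in> \<pp>"
  and \<pp>_in_B: "x \<in> \<pp> \<Longrightarrow> x \<in> B"
  and \<pp>_1: "1 \<notin> \<pp>"
  and \<pp>_prime: "x \<in> B \<Longrightarrow> y \<in> B \<Longrightarrow> x * y \<in> \<pp> \<Longrightarrow> x \<in> \<pp> \<or> y \<in> \<pp>"
proof -
  interpret B: cring "integral_closure_ring L"
    by (rule cring_integral_closure)
  interpret \<pp>: primeideal \<pp> "integral_closure_ring L"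
    by (rule primeideal_\<pp>)
  show "x \<in> \<pp> \<Longrightarrow> y \<in> \<pp> \<Longrightarrow> x + y \<in> \<pp>"
    using \<pp>.a_closed[of x y] by simp
  show "x \<in> B \<Longrightarrow> y \<in> \<pp> \<Longrightarrow> x * y \<in> \<pp>"
    using \<pp>.I_l_closed[of y x] by simp
  show "0 \<in> \<pp>"
    using \<pp>.zero_closed by simp
  show "x \<in> \<pp> \<Longrightarrow> x \<in> B"
    using \<pp>.Icarr[of x] by simp
  show "1 \<notin> \<pp>"
    using \<pp>.one_imp_carrier \<pp>.I_notcarr by auto
  show "x \<in> B \<Longrightarrow> y \<in> B \<Longrightarrow> x * y \<in> \<pp> \<Longrightarrow> x \<in> \<pp> \<or> y \<in> \<pp>"
    using \<pp>.I_prime[of x y] by simp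
qed

lemma \<pp>_uminus: "x \<in> \<pp> \<Longrightarrow> - x \<in> \<pp>"
  using \<pp>_mult[of "- 1" x] B_closed(6)[of 1] by simp

lemma \<pp>_diff: "x \<in> \<pp> \<Longrightarrow> y \<in> \<pp> \<Longrightarrow> x - y \<in> \<pp>"
  using \<pp>_add[of x "- y"] \<pp>_uminus[of y] by simp

lemma \<pp>_emb_iff: "emb r \<in> \<pp> \<longleftrightarrow> P dvd r"
proof -
  have "{r. emb r \<in> \<pp>} = prime_ideal_of P"
    using \<pp>_over unfolding primes_over_def poly_to_bar_eq_emb by blast
  then show ?thesis
    using mem_prime_ideal_of_iff by blast
qed

lemma \<pp>_prod:
  assumes "\<And>a. a \<in> A \<Longrightarrow> f a \<in> B" "prod f A \<in> \<pp>"
  shows "\<exists>a\<in>A. f a \<in> \<pp>"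
  using assms
proof (induction A rule: infinite_finite_induct)
  case (insert a A)
  then have "f a \<in> \<pp> \<or> prod f A \<in> \<pp>"
    by (intro \<pp>_prime) auto
  then show ?case
    using insert by auto
qed (auto simp: \<pp>_1)

lemma \<pp>_power:
  assumes "x \<in> B" "x ^ n \<in> \<pp>"
  shows "x \<in> \<pp>"
  using \<pp>_prod[of "{..<n}" "\<lambda>_. x"] assms by auto

lemma \<pp>_power_diff:
  assumes "x \<in> B" "y \<in> B" "x - y \<in> \<pp>"
  shows "x ^ n - y ^ n \<in> \<pp>"
proof (induction n)
  case (Suc n)
  have "x ^ Suc n - y ^ Suc n = x * (x ^ n - y ^ n) + y ^ n * (x - y)"
    by (simp add: algebra_simps)
  then show ?case
    using Suc assms by (simp add: \<pp>_add \<pp>_mult)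
qed (simp add: \<pp>_0)

end

section \<open>Norms, interpolation sums and primes with a simple root of M\<close>

subsection \<open>Primes that split completely\<close>

context galois_ext
begin

text \<open>The norm of an integral element is integral and Galois invariant, hence in R.\<close>

lemma galois_prod_in_range_emb:
  assumes x: "x \<in> B"
  shows "(\<Prod>\<sigma>\<in>\<Gamma>. \<sigma> x) \<in> range emb"
proof (rule fixed_B_in_range_emb)
  show "(\<Prod>\<sigma>\<in>\<Gamma>. \<sigma> x) \<in> B"
    using x by (intro B_prod) (simp add: galois_B)
next
  fix \<rho> assume \<rho>: "\<rho> \<in> \<Gamma>"
  have "\<rho> (\<Prod>\<sigma>\<in>\<Gamma>. \<sigma> x) = (\<Prod>\<sigma>\<in>\<Gamma>. \<rho> (\<sigma> x))"
    using \<rho> B_in_L[OF x] by (intro galois_prod) (simp_all add: galois_closed)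
  also have "\<dots> = (\<Prod>\<sigma>\<in>\<Gamma>. compose L \<rho> \<sigma> x)"
    using B_in_L[OF x] by (intro prod.cong) (auto simp: compose_eq)
  also have "\<dots> = (\<Prod>\<sigma>\<in>\<Gamma>. \<sigma> x)"
    by (rule prod.reindex_bij_betw[OF bij_betw_galois_compose[OF \<rho>]])
  finally show "\<rho> (\<Prod>\<sigma>\<in>\<Gamma>. \<sigma> x) = (\<Prod>\<sigma>\<in>\<Gamma>. \<sigma> x)" .
qed

lemma galois_eq_0_iff:
  assumes "\<sigma> \<in> \<Gamma>" "x \<in> L"
  shows "\<sigma> x = 0 \<longleftrightarrow> x = 0"
proof
  assume "\<sigma> x = 0"
  then have "\<sigma> x = \<sigma> 0"
    using assms by (simp add: galois_0_1)
  moreover have "inj_on \<sigma> L"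
    using galois_Bij[OF assms(1)] by (simp add: Bij_def bij_betw_def)
  ultimately show "x = 0"
    using assms(2) by (auto dest: inj_onD)
qed (use assms in \<open>simp add: galois_0_1\<close>)

text \<open>Lagrange interpolation without denominators: with M the product of t - \<tau>(b) over
  \<Gamma>, the value at r = \<sigma>(b) is \<sigma>(x) M'(\<sigma>(b)). For r in R that is no
  conjugate of b, it is the trace of x M(r) / (r - b).\<close>

definition interpol :: "'a ratfun_bar \<Rightarrow> 'a ratfun_bar \<Rightarrow> 'a ratfun_bar \<Rightarrow> 'a ratfun_bar"
  where "interpol r b x = (\<Sum>\<sigma>\<in>\<Gamma>. \<sigma> x * (\<Prod>\<tau>\<in>\<Gamma> - {\<sigma>}. r - \<tau> b))"

text \<open>Applying \<rho> carries the summand of \<sigma> to that of \<rho>\<sigma>, so the sum is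
  invariant; it is also integral.\<close>

lemma interpol_in_range_emb:
  assumes x: "x \<in> B" and b: "b \<in> B"
  shows "interpol (emb r) b x \<in> range emb"
proof (rule fixed_B_in_range_emb)
  show "interpol (emb r) b x \<in> B"
    unfolding interpol_def using assms by (intro B_sum B_closed(5) B_prod) (simp_all add: galois_B)
next
  fix \<rho> assume \<rho>: "\<rho> \<in> \<Gamma>"
  let ?c = "compose L \<rho>"
  have L: "x \<in> L" "b \<in> L"
    using assms B_in_L by auto
  have bij: "bij_betw ?c \<Gamma> \<Gamma>"
    using \<rho> by (rule bij_betw_galois_compose)
  have "\<rho> (\<sigma> x * (\<Prod>\<tau>\<in>\<Gamma> - {\<sigma>}. emb r - \<tau> b)) = ?c \<sigma> x * (\<Prod>\<tau>\<in>\<Gamma> - {?c \<sigma>}. emb r - \<tau> b)"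
    if \<sigma>: "\<sigma> \<in> \<Gamma>" for \<sigma>
  proof -
    have "\<rho> (\<sigma> x * (\<Prod>\<tau>\<in>\<Gamma> - {\<sigma>}. emb r - \<tau> b)) = \<rho> (\<sigma> x) * \<rho> (\<Prod>\<tau>\<in>\<Gamma> - {\<sigma>}. emb r - \<tau> b)"
      using \<rho> \<sigma> L by (intro galois_mult[OF \<rho>] L_prod) (simp_all add: galois_closed)
    also have "\<rho> (\<Prod>\<tau>\<in>\<Gamma> - {\<sigma>}. emb r - \<tau> b) = (\<Prod>\<tau>\<in>\<Gamma> - {\<sigma>}. \<rho> (emb r - \<tau> b))"
      using \<rho> L by (intro galois_prod[OF \<rho>]) (simp add: galois_closed)
    also have "\<dots> = (\<Prod>\<tau>\<in>\<Gamma> - {\<sigma>}. emb r - ?c \<tau> b)"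
      using \<rho> L by (intro prod.cong) (auto simp: galois_diff galois_emb galois_closed compose_eq)
    also have "\<dots> = (\<Prod>\<tau>\<in>\<Gamma> - {?c \<sigma>}. emb r - \<tau> b)"
    proof -
      \<comment> \<open>Left translation by \<rho> also respects the omitted index, so the inner
        product can be reindexed.\<close>
      have "bij_betw ?c (\<Gamma> - {\<sigma>}) (\<Gamma> - {?c \<sigma>})"
        using bij_betw_DiffI[OF bij, of "{\<sigma>}" "{?c \<sigma>}"] \<sigma> bij
        by (auto simp: bij_betw_def)
      then show ?thesis
        by (rule prod.reindex_bij_betw)
    qed
    finally show ?thesis
      using L by (simp add: compose_eq)
  qed
  then have "\<rho> (interpol (emb r) b x) = (\<Sum>\<sigma>\<in>\<Gamma>. ?c \<sigma> x * (\<Prod>\<tau>\<in>\<Gamma> - {?c \<sigma>}. emb r - \<tau> b))"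
    unfolding interpol_def using \<rho> L
    by (subst galois_sum) (auto intro!: L_prod L_closed sum.cong simp: galois_closed)
  also have "\<dots> = interpol (emb r) b x"
    unfolding interpol_def
    by (rule sum.reindex_bij_betw[OF bij, of "\<lambda>\<sigma>. \<sigma> x * (\<Prod>\<tau>\<in>\<Gamma> - {\<sigma>}. emb r - \<tau> b)"])
  finally show "\<rho> (interpol (emb r) b x) = interpol (emb r) b x" .
qed

abbreviation \<iota> :: "'a ratfun_bar \<Rightarrow> 'a ratfun_bar"
  where "\<iota> \<equiv> \<one>\<^bsub>galois_group L\<^esub>"

lemma galois_one: "\<iota> \<in> \<Gamma>"
  unfolding one_galois_group by (rule galois_id)

lemma galois_one_apply [simp]: "x \<in> L \<Longrightarrow> \<iota> x = x"
  by (simp add: one_galois_group)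

text \<open>Every summand with \<sigma> different from the identity contains the factor r -
  \<iota>(b) = r - b.\<close>

lemma interpol_split:
  assumes x: "x \<in> B" and b: "b \<in> B"
  obtains y where "y \<in> B" "interpol (emb r) b x = x * (\<Prod>\<tau>\<in>\<Gamma> - {\<iota>}. emb r - \<tau> b) + (emb r - b) * y"
proof -
  define y where "y = (\<Sum>\<sigma>\<in>\<Gamma> - {\<iota>}. \<sigma> x * (\<Prod>\<tau>\<in>\<Gamma> - {\<sigma>} - {\<iota>}. emb r - \<tau> b))"
  have "interpol (emb r) b x = \<iota> x * (\<Prod>\<tau>\<in>\<Gamma> - {\<iota>}. emb r - \<tau> b) +
      (\<Sum>\<sigma>\<in>\<Gamma> - {\<iota>}. \<sigma> x * (\<Prod>\<tau>\<in>\<Gamma> - {\<sigma>}. emb r - \<tau> b))"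
    unfolding interpol_def by (rule sum.remove[OF finite_galois_group galois_one])
  also have "(\<Sum>\<sigma>\<in>\<Gamma> - {\<iota>}. \<sigma> x * (\<Prod>\<tau>\<in>\<Gamma> - {\<sigma>}. emb r - \<tau> b)) = (emb r - b) * y"
    unfolding y_def sum_distrib_left
  proof (intro sum.cong refl)
    fix \<sigma> assume "\<sigma> \<in> \<Gamma> - {\<iota>}"
    then have "\<iota> \<in> \<Gamma> - {\<sigma>}"
      using galois_one by blast
    then have "(\<Prod>\<tau>\<in>\<Gamma> - {\<sigma>}. emb r - \<tau> b) = (emb r - \<iota> b) * (\<Prod>\<tau>\<in>\<Gamma> - {\<sigma>} - {\<iota>}. emb r - \<tau> b)"
      by (rule prod.remove[OF finite_Diff[OF finite_galois_group]])
    then show "\<sigma> x * (\<Prod>\<tau>\<in>\<Gamma> - {\<sigma>}. emb r - \<tau> b) =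
        (emb r - b) * (\<sigma> x * (\<Prod>\<tau>\<in>\<Gamma> - {\<sigma>} - {\<iota>}. emb r - \<tau> b))"
      using B_in_L[OF b] by simp
  qed
  finally have "interpol (emb r) b x = x * (\<Prod>\<tau>\<in>\<Gamma> - {\<iota>}. emb r - \<tau> b) + (emb r - b) * y"
    using B_in_L[OF x] by simp
  moreover have "y \<in> B"
    unfolding y_def using assms by (intro B_sum B_closed(5) B_prod) (simp_all add: galois_B)
  ultimately show ?thesis
    using that by blast
qed

end

text \<open>In the application b is the conjugate of \<beta> to which r is congruent modulo \<pp>.
  The last assumption makes b a simple root, modulo \<pp>, of the product of t - \<tau>(b); it comes
  from P not dividing the norm of the product of differences of conjugates.\<close>

locale split_prime_over = prime_over L P \<pp>
  for L :: "'a::{field, finite} ratfun_bar set" and P \<pp> +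
  fixes b :: "'a ratfun_bar" and r :: "'a poly"
  assumes b_B: "b \<in> B" and b_cong: "emb r - b \<in> \<pp>"
    and b_conj: "\<And>\<tau>. \<tau> \<in> \<Gamma> \<Longrightarrow> b - \<tau> b \<in> \<pp> \<Longrightarrow> \<tau> = \<iota>"
begin

text \<open>This is M(r) / (r - b) for r different from b. Modulo \<pp> it is congruent to M'(b),
  which is nonzero there because the root b is simple.\<close>

definition e :: "'a ratfun_bar"
  where "e = (\<Prod>\<tau>\<in>\<Gamma> - {\<iota>}. emb r - \<tau> b)"

lemma e_B: "e \<in> B"
  unfolding e_def using b_B by (intro B_prod) (simp add: galois_B)

lemma e_notin: "e \<notin> \<pp>"
proof
  assume "e \<in> \<pp>"
  then obtain \<tau> where \<tau>: "\<tau> \<in> \<Gamma> - {\<iota>}" "emb r - \<tau> b \<in> \<pp>"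
    unfolding e_def using b_B \<pp>_prod[of "\<Gamma> - {\<iota>}" "\<lambda>\<tau>. emb r - \<tau> b"]
    by (auto simp: galois_B)
  from \<tau>(2) have "(emb r - \<tau> b) - (emb r - b) \<in> \<pp>"
    using b_cong by (rule \<pp>_diff)
  then have "b - \<tau> b \<in> \<pp>"
    by (simp add: algebra_simps)
  then show False
    using b_conj \<tau>(1) by blast
qed

lemma interpol_cong:
  assumes "x \<in> B"
  obtains h y where "y \<in> B" "emb h = x * e + (emb r - b) * y"
  using interpol_split[OF assms b_B, of r] interpol_in_range_emb[OF assms b_B, of r]
  unfolding e_def by (metis rangeE)

text \<open>Interpolating x and 1 gives h2 congruent to x e and h1 congruent to e modulo \<pp>, so
  h1 x is congruent to h2. As e is not in \<pp>, P does not divide h1, and an inverse w of h1 modulo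
  P makes x congruent to w h2.\<close>

lemma residue_degree_one:
  assumes x: "x \<in> B"
  obtains h where "x - emb h \<in> \<pp>"
proof -
  \<comment> \<open>The case x = 1 replaces e by an element of R, where inverses modulo P are
    available.\<close>
  obtain h1 y1 where h1: "y1 \<in> B" "emb h1 = 1 * e + (emb r - b) * y1"
    by (rule interpol_cong[OF B_closed(2)])
  obtain h2 y2 where h2: "y2 \<in> B" "emb h2 = x * e + (emb r - b) * y2"
    by (rule interpol_cong[OF x])
  have "emb h1 - e = y1 * (emb r - b)"
    using h1(2) by simp
  then have d1: "emb h1 - e \<in> \<pp>"
    using b_cong h1(1) by (simp add: \<pp>_mult)
  have "emb h1 * x - emb h2 = (x * y1 - y2) * (emb r - b)"
    unfolding h1(2) h2(2) by (simp add: algebra_simps)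
  then have d2: "emb h1 * x - emb h2 \<in> \<pp>"
    using b_cong h1(1) h2(1) x by (simp add: \<pp>_mult)
  have "emb h1 \<notin> \<pp>"
    using \<pp>_diff[OF _ d1, of "emb h1"] e_notin by auto
  then have "\<not> P dvd h1"
    by (simp add: \<pp>_emb_iff)
  then obtain w where "P dvd h1 * w - 1"
    using irreducible_inverse_mod[OF irreducible_P] by blast
  then have d3: "x * emb (h1 * w - 1) \<in> \<pp>"
    using x by (intro \<pp>_mult) (simp_all only: \<pp>_emb_iff)
  have "emb w * (emb h1 * x - emb h2) \<in> \<pp>"
    using d2 by (intro \<pp>_mult) auto
  then have "emb w * (emb h1 * x - emb h2) - x * emb (h1 * w - 1) \<in> \<pp>"
    using d3 by (rule \<pp>_diff)
  also have "emb w * (emb h1 * x - emb h2) - x * emb (h1 * w - 1) = x - emb (w * h2)"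
    by (simp add: algebra_simps)
  finally show ?thesis
    by (rule that)
qed

text \<open>With x congruent to h in R, Fermat's theorem gives x congruent to its power with
  exponent q^deg P. Since \<open>frobenius\<close> is a definite description, uniqueness is shown as
  well: a competitor \<sigma> satisfies \<sigma>(b) congruent to b, so simplicity of the root forces
  \<sigma> = \<iota>.\<close>

lemma frobenius_eq_id: "frobenius L P \<pp> = \<iota>"
proof -
  have frob: "x - x ^ (CARD('a) ^ Polynomial.degree P) \<in> \<pp>" if x: "x \<in> B" for x
  proof -
    let ?Q = "CARD('a) ^ Polynomial.degree P"
    obtain h where h: "x - emb h \<in> \<pp>"
      by (rule residue_degree_one[OF x])
    have pow: "x ^ ?Q - emb h ^ ?Q \<in> \<pp>"
      using x h by (intro \<pp>_power_diff) auto
    have fermat: "emb (h ^ ?Q - h) \<in> \<pp>"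
      unfolding \<pp>_emb_iff by (rule irreducible_dvd_frobenius_diff[OF irreducible_P])
    have "x - emb h - (x ^ ?Q - emb h ^ ?Q) - emb (h ^ ?Q - h) \<in> \<pp>"
      by (rule \<pp>_diff[OF \<pp>_diff[OF h pow] fermat])
    then show ?thesis
      by simp
  qed
  show ?thesis
    unfolding frobenius_def
  proof (rule the_equality)
    show "\<iota> \<in> \<Gamma> \<and> (\<forall>x\<in>B. \<iota> x - x ^ CARD('a) ^ Polynomial.degree P \<in> \<pp>)"
      using galois_one frob B_in_L by auto
  next
    fix \<sigma>
    assume \<sigma>: "\<sigma> \<in> \<Gamma> \<and> (\<forall>x\<in>B. \<sigma> x - x ^ CARD('a) ^ Polynomial.degree P \<in> \<pp>)"
    then have "\<sigma> b - b ^ (CARD('a) ^ Polynomial.degree P) \<in> \<pp>"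
      using b_B by blast
    from \<pp>_diff[OF frob[OF b_B] this]
    have "b - \<sigma> b \<in> \<pp>"
      by simp
    then show "\<sigma> = \<iota>"
      using b_conj \<sigma> by blast
  qed
qed

text \<open>For a in \<pp>, interpolation writes e a = h - (r - b) y with h in R. Both h and e (r -
  b) = M(r) lie in \<pp> and in R, hence are multiples of P; one more factor e makes the second of
  them appear.\<close>

lemma e_square_mult:
  assumes "a \<in> \<pp>"
  obtains z where "z \<in> B" "e\<^sup>2 * a = emb P * z"
proof -
  have a: "a \<in> B"
    using assms by (rule \<pp>_in_B)
  obtain h y where h: "y \<in> B" "emb h = a * e + (emb r - b) * y"
    by (rule interpol_cong[OF a])
  have "e * a + y * (emb r - b) \<in> \<pp>"
    by (rule \<pp>_add[OF \<pp>_mult[OF e_B assms] \<pp>_mult[OF h(1) b_cong]])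
  then have "emb h \<in> \<pp>"
    unfolding h(2) by (simp add: mult.commute)
  then obtain h' where h': "h = P * h'"
    by (auto simp: \<pp>_emb_iff dvd_def)
  \<comment> \<open>e (r - b) is the norm of r - b, hence an element of R.\<close>
  have "(\<Prod>\<tau>\<in>\<Gamma>. \<tau> (emb r - b)) = (\<Prod>\<tau>\<in>\<Gamma>. emb r - \<tau> b)"
    using B_in_L[OF b_B] by (intro prod.cong) (auto simp: galois_diff galois_emb)
  also have "\<dots> = (emb r - \<iota> b) * e"
    unfolding e_def by (rule prod.remove[OF finite_galois_group galois_one])
  also have "\<dots> = e * (emb r - b)"
    using B_in_L[OF b_B] by simp
  finally have "e * (emb r - b) \<in> range emb"
    using galois_prod_in_range_emb[of "emb r - b"] b_B by simp
  then obtain m where m: "e * (emb r - b) = emb m"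
    by blast
  have "e * (emb r - b) \<in> \<pp>"
    using e_B b_cong by (rule \<pp>_mult)
  then obtain m' where m': "m = P * m'"
    unfolding m by (auto simp: \<pp>_emb_iff dvd_def)
  have "e\<^sup>2 * a = e * emb h - (e * (emb r - b)) * y"
    unfolding h(2) by (simp add: algebra_simps power2_eq_square)
  also have "\<dots> = emb P * (e * emb h' - emb m' * y)"
    unfolding m h' m' by (simp add: algebra_simps)
  finally have "e\<^sup>2 * a = emb P * (e * emb h' - emb m' * y)" .
  moreover have "e * emb h' - emb m' * y \<in> B"
    using e_B h(1) by auto
  ultimately show ?thesis
    using that by metis
qed

text \<open>Each factor of a product from \<pp> \<pp> absorbs e^2, so e^4 maps the square of \<pp>
  into P^2 R_L. If P were in that square, cancelling P would put e^4 into P R_L and hence e into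
  \<pp>.\<close>

lemma unramified: "unramified L P \<pp>"
proof -
  have prod: "\<exists>z\<in>B. e ^ 4 * s = emb P * (emb P * z)"
    if "s \<in> ideal_prod (integral_closure_ring L) \<pp> \<pp>" for s
    using that
  proof induction
    case (prod i j)
    obtain z where z: "z \<in> B" "e\<^sup>2 * i = emb P * z"
      using e_square_mult[OF prod(1)] .
    obtain w where w: "w \<in> B" "e\<^sup>2 * j = emb P * w"
      using e_square_mult[OF prod(2)] .
    have "e ^ 4 * (i * j) = (e\<^sup>2 * i) * (e\<^sup>2 * j)"
      by (simp add: eval_nat_numeral algebra_simps)
    also have "\<dots> = emb P * (emb P * (z * w))"
      unfolding z w by (simp add: algebra_simps)
    finally show ?case
      using z(1) w(1) by (intro bexI[of _ "z * w"]) auto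
  next
    case (sum s1 s2)
    then obtain z w where "z \<in> B" "e ^ 4 * s1 = emb P * (emb P * z)"
      "w \<in> B" "e ^ 4 * s2 = emb P * (emb P * w)"
      by blast
    then show ?case
      by (intro bexI[of _ "z + w"]) (auto simp: distrib_left)
  qed
  show ?thesis
    unfolding unramified_def poly_to_bar_eq_emb
  proof
    assume "emb P \<in> ideal_prod (integral_closure_ring L) \<pp> \<pp>"
    then obtain z where z: "z \<in> B" "e ^ 4 * emb P = emb P * (emb P * z)"
      using prod by blast
    have "P \<noteq> 0"
      using irreducible_P by auto
    then have "e ^ 4 = z * emb P"
      using z(2) by simp
    moreover have "emb P \<in> \<pp>"
      by (simp add: \<pp>_emb_iff)
    ultimately have "e ^ 4 \<in> \<pp>"
      using z(1) by (simp add: \<pp>_mult)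
    then show False
      using \<pp>_power[OF e_B] e_notin by blast
  qed
qed

end

section \<open>The conjugates polynomial over R and the infinitude of split primes\<close>

context galois_ext
begin

text \<open>Coefficientwise application of \<rho> is expressed through separate polynomials p' and
  q', since \<rho> is known to be a homomorphism only on L, not on the whole algebraic
  closure.\<close>

lemma galois_coeff_mult:
  assumes "\<rho> \<in> \<Gamma>" "\<And>i. Polynomial.coeff p i \<in> L" "\<And>i. Polynomial.coeff q i \<in> L"
    and "\<And>i. Polynomial.coeff p' i = \<rho> (Polynomial.coeff p i)"
    and "\<And>i. Polynomial.coeff q' i = \<rho> (Polynomial.coeff q i)"
  shows "Polynomial.coeff (p' * q') i = \<rho> (Polynomial.coeff (p * q) i)"
  unfolding Polynomial.coeff_mult using assms
  by (subst galois_sum) (auto simp: galois_mult)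

lemma coeff_prod_in_B:
  assumes "\<And>a i. a \<in> A \<Longrightarrow> Polynomial.coeff (f a) i \<in> B"
  shows "Polynomial.coeff (prod f A) i \<in> B"
  using assms
proof (induction A arbitrary: i rule: infinite_finite_induct)
  case (insert a A)
  then show ?case
    by (auto simp: Polynomial.coeff_mult intro!: B_sum B_closed)
qed (auto simp: Polynomial.coeff_1)

lemma galois_coeff_prod:
  assumes "\<rho> \<in> \<Gamma>" "\<And>a. a \<in> A \<Longrightarrow> f a \<in> B"
  shows "Polynomial.coeff (\<Prod>a\<in>A. [:- \<rho> (f a), 1:]) i = \<rho> (Polynomial.coeff (\<Prod>a\<in>A. [:- f a, 1:]) i)"
  using assms(2)
proof (induction A arbitrary: i rule: infinite_finite_induct)
  case (insert a A)
  have "Polynomial.coeff ([:- \<rho> (f a), 1:] * (\<Prod>a\<in>A. [:- \<rho> (f a), 1:])) i =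
      \<rho> (Polynomial.coeff ([:- f a, 1:] * (\<Prod>a\<in>A. [:- f a, 1:])) i)"
  proof (rule galois_coeff_mult[OF assms(1)])
    show "Polynomial.coeff [:- f a, 1:] i \<in> L" for i
      using insert.prems[of a] by (auto simp: coeff_pCons B_in_L split: nat.splits)
    show "Polynomial.coeff (\<Prod>a\<in>A. [:- f a, 1:]) i \<in> L" for i
      using insert.prems by (intro B_in_L coeff_prod_in_B) (auto simp: coeff_pCons split: nat.splits)
    show "Polynomial.coeff [:- \<rho> (f a), 1:] i = \<rho> (Polynomial.coeff [:- f a, 1:] i)" for i
      using insert.prems[of a] assms(1)
      by (auto simp: coeff_pCons B_in_L galois_uminus galois_0_1 split: nat.splits)
    show "Polynomial.coeff (\<Prod>a\<in>A. [:- \<rho> (f a), 1:]) i = \<rho> (Polynomial.coeff (\<Prod>a\<in>A. [:- f a, 1:]) i)" for i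
      using insert by auto
  qed
  then show ?case
    using insert by simp
qed (use assms(1) in \<open>auto simp: Polynomial.coeff_1 galois_0_1\<close>)

text \<open>The coefficients are integral and Galois invariant, so the polynomial descends to R; M
  is rebuilt from the preimages of its coefficients.\<close>

lemma exists_conjugates_poly:
  assumes b: "b \<in> B"
  obtains M where "Polynomial.degree M > 0" "\<And>r. emb (poly M r) = (\<Prod>\<sigma>\<in>\<Gamma>. emb r - \<sigma> b)"
proof -
  define N where "N = (\<Prod>\<sigma>\<in>\<Gamma>. [:- \<sigma> b, 1:])"
  have bL: "b \<in> L"
    using b by (rule B_in_L)
  have "Polynomial.coeff N i \<in> range emb" for i
  proof (rule fixed_B_in_range_emb)
    show "Polynomial.coeff N i \<in> B"
      unfolding N_def using b by (intro coeff_prod_in_B) (auto simp: coeff_pCons galois_B split: nat.splits)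
    fix \<rho> assume \<rho>: "\<rho> \<in> \<Gamma>"
    have "\<rho> (Polynomial.coeff N i) = Polynomial.coeff (\<Prod>\<sigma>\<in>\<Gamma>. [:- \<rho> (\<sigma> b), 1:]) i"
      unfolding N_def using galois_coeff_prod[OF \<rho>, of \<Gamma> "\<lambda>\<sigma>. \<sigma> b" i] galois_B[OF _ b] by simp
    also have "(\<Prod>\<sigma>\<in>\<Gamma>. [:- \<rho> (\<sigma> b), 1:]) = (\<Prod>\<sigma>\<in>\<Gamma>. [:- compose L \<rho> \<sigma> b, 1:])"
      using bL by (intro prod.cong) (auto simp: compose_eq)
    also have "\<dots> = N"
      unfolding N_def
      by (rule prod.reindex_bij_betw[OF bij_betw_galois_compose[OF \<rho>], of "\<lambda>\<sigma>. [:- \<sigma> b, 1:]"])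
    finally show "\<rho> (Polynomial.coeff N i) = Polynomial.coeff N i" .
  qed
  then have "\<forall>i. \<exists>r. Polynomial.coeff N i = emb r"
    by blast
  then obtain c where c: "\<And>i. Polynomial.coeff N i = emb (c i)"
    by metis
  have degN: "Polynomial.degree N = card \<Gamma>"
    unfolding N_def by (subst degree_prod_eq_sum_degree) auto
  have "card \<Gamma> > 0"
    using galois_one finite_galois_group by (auto simp: card_gt_0_iff)
  define M where "M = (\<Sum>i\<le>card \<Gamma>. Polynomial.monom (c i) i)"
  have coeffM: "Polynomial.coeff M i = c i" for i
  proof (cases "i \<le> card \<Gamma>")
    case True
    then show ?thesis
      by (simp add: M_def Polynomial.coeff_sum)
  next
    case False
    then have "emb (c i) = 0"
      using c[of i] degN by (simp add: coeff_eq_0)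
    with False show ?thesis
      by (simp add: M_def Polynomial.coeff_sum)
  qed
  have "map_poly emb M = N"
    by (rule poly_eqI) (simp add: coeff_map_poly coeffM c)
  have "emb (poly M r) = poly N (emb r)" for r
  proof -
    have "emb (poly M r) = (\<Sum>i\<le>Polynomial.degree M. emb (Polynomial.coeff M i) * emb r ^ i)"
      by (simp add: poly_altdef emb_sum)
    also have "\<dots> = poly N (emb r)"
      by (simp flip: \<open>map_poly emb M = N\<close> add: poly_map_poly_emb)
    finally show ?thesis .
  qed
  then have eval: "emb (poly M r) = (\<Prod>\<sigma>\<in>\<Gamma>. emb r - \<sigma> b)" for r
    by (simp add: N_def poly_prod)
  have "Polynomial.degree M = Polynomial.degree N"
    unfolding \<open>map_poly emb M = N\<close>[symmetric] by (rule degree_map_poly[symmetric]) simp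
  then have "Polynomial.degree M > 0"
    using \<open>card \<Gamma> > 0\<close> degN by simp
  then show ?thesis
    using eval by (rule that)
qed

text \<open>The primes found are those dividing some value M(r) but not N, where N excludes the
  finitely many P modulo which conjugates of \<beta> might collide.\<close>

lemma infinite_split_primes:
  "infinite {P \<in> monic_primes. \<forall>\<pp>\<in>primes_over L P. unramified L P \<pp> \<and> frobenius L P \<pp> = \<iota>}"
proof -
  obtain \<beta> where \<beta>: "\<beta> \<in> L" "integral_elem \<beta>"
    and prim: "\<And>\<sigma> \<tau>. \<sigma> \<in> \<Gamma> \<Longrightarrow> \<tau> \<in> \<Gamma> \<Longrightarrow> \<sigma> \<beta> = \<tau> \<beta> \<Longrightarrow> \<sigma> = \<tau>"
    by (rule exists_integral_primitive_element) blast
  have \<beta>B: "\<beta> \<in> B"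
    using \<beta> by (simp add: mem_B_iff)
  obtain M where M: "Polynomial.degree M > 0" "\<And>r. emb (poly M r) = (\<Prod>\<sigma>\<in>\<Gamma>. emb r - \<sigma> \<beta>)"
    by (rule exists_conjugates_poly[OF \<beta>B]) blast
  define S where "S = {(\<sigma>, \<tau>) \<in> \<Gamma> \<times> \<Gamma>. \<sigma> \<noteq> \<tau>}"
  have finS: "finite S"
    unfolding S_def by (rule finite_subset[of _ "\<Gamma> \<times> \<Gamma>"]) (auto simp: finite_galois_group)
  \<comment> \<open>Up to sign, \<delta> is the discriminant of M; it is nonzero because the
    conjugates of \<beta> are distinct.\<close>
  define \<delta> where "\<delta> = (\<Prod>(\<sigma>, \<tau>)\<in>S. \<sigma> \<beta> - \<tau> \<beta>)"
  have \<delta>B: "\<delta> \<in> B"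
    unfolding \<delta>_def S_def using \<beta>B by (intro B_prod) (auto simp: galois_B)
  have "\<delta> \<noteq> 0"
    unfolding \<delta>_def using finS prim by (auto simp: S_def)
  \<comment> \<open>Taking the norm of \<delta> places it in R without a separate proof that
    \<delta> is invariant.\<close>
  obtain N where N: "emb N = (\<Prod>\<sigma>\<in>\<Gamma>. \<sigma> \<delta>)"
    using galois_prod_in_range_emb[OF \<delta>B] by (metis rangeE)
  have "emb N \<noteq> 0"
    unfolding N using \<open>\<delta> \<noteq> 0\<close> finite_galois_group B_in_L[OF \<delta>B] by (simp add: galois_eq_0_iff)
  then have N0: "N \<noteq> 0"
    by auto
  have "infinite ({P \<in> monic_primes. \<exists>r. P dvd poly M r} - {P \<in> monic_primes. P dvd N})"
    using infinite_monic_primes_dvd_values[OF M(1)] finite_monic_primes_dvd[OF N0]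
    by (rule Diff_infinite_finite[rotated])
  moreover have "unramified L P \<pp> \<and> frobenius L P \<pp> = \<iota>"
    if P: "P \<in> monic_primes" "P dvd poly M r" "\<not> P dvd N" and \<pp>: "\<pp> \<in> primes_over L P" for P r \<pp>
  proof -
    interpret prime_over L P \<pp>
      by unfold_locales (fact P(1) \<pp>)+
    have "(\<Prod>\<sigma>\<in>\<Gamma>. emb r - \<sigma> \<beta>) \<in> \<pp>"
      using P(2) by (simp flip: M(2) add: \<pp>_emb_iff)
    then obtain \<sigma> where \<sigma>: "\<sigma> \<in> \<Gamma>" "emb r - \<sigma> \<beta> \<in> \<pp>"
      using \<pp>_prod[of \<Gamma> "\<lambda>\<sigma>. emb r - \<sigma> \<beta>"] \<beta>B by (auto simp: galois_B)
    have "\<tau> = \<iota>" if \<tau>: "\<tau> \<in> \<Gamma>" "\<sigma> \<beta> - \<tau> (\<sigma> \<beta>) \<in> \<pp>" for \<tau>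
    proof (rule ccontr)
      assume "\<tau> \<noteq> \<iota>"
      \<comment> \<open>Hence the pair (\<sigma>, \<tau>\<sigma>) contributes a factor to \<delta>.
        That factor lies in \<pp>, so \<delta> and N do as well, against the choice of P.\<close>
      have "compose L \<tau> \<sigma> \<noteq> \<sigma>"
      proof
        assume "compose L \<tau> \<sigma> = \<sigma>"
        then have "\<tau> \<otimes>\<^bsub>galois_group L\<^esub> \<sigma> = \<sigma>"
          using \<tau>(1) \<sigma>(1) by (simp add: mult_galois_group)
        then show False
          using group.r_cancel_one[OF group_galois_group] \<tau>(1) \<sigma>(1) \<open>\<tau> \<noteq> \<iota>\<close> by blast
      qed
      then have mem: "(\<sigma>, compose L \<tau> \<sigma>) \<in> S"
        unfolding S_def using \<sigma>(1) galois_compose[OF \<tau>(1) \<sigma>(1)] by simp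
      have "\<delta> = (\<sigma> \<beta> - compose L \<tau> \<sigma> \<beta>) * (\<Prod>(\<sigma>, \<tau>)\<in>S - {(\<sigma>, compose L \<tau> \<sigma>)}. \<sigma> \<beta> - \<tau> \<beta>)"
        unfolding \<delta>_def by (subst prod.remove[OF finS mem]) simp
      also have "\<sigma> \<beta> - compose L \<tau> \<sigma> \<beta> = \<sigma> \<beta> - \<tau> (\<sigma> \<beta>)"
        using \<beta>(1) by (simp add: compose_eq)
      finally have "\<delta> = (\<Prod>(\<sigma>, \<tau>)\<in>S - {(\<sigma>, compose L \<tau> \<sigma>)}. \<sigma> \<beta> - \<tau> \<beta>) * (\<sigma> \<beta> - \<tau> (\<sigma> \<beta>))"
        by simp
      moreover have "(\<Prod>(\<sigma>, \<tau>)\<in>S - {(\<sigma>, compose L \<tau> \<sigma>)}. \<sigma> \<beta> - \<tau> \<beta>) \<in> B"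
        unfolding S_def using \<beta>B by (intro B_prod) (auto simp: galois_B)
      ultimately have "\<delta> \<in> \<pp>"
        using \<tau>(2) by (simp add: \<pp>_mult)
      have "emb N = \<iota> \<delta> * (\<Prod>\<sigma>\<in>\<Gamma> - {\<iota>}. \<sigma> \<delta>)"
        unfolding N by (rule prod.remove[OF finite_galois_group galois_one])
      also have "\<dots> = (\<Prod>\<sigma>\<in>\<Gamma> - {\<iota>}. \<sigma> \<delta>) * \<delta>"
        using B_in_L[OF \<delta>B] by simp
      also have "\<dots> \<in> \<pp>"
        using \<open>\<delta> \<in> \<pp>\<close> \<delta>B by (intro \<pp>_mult B_prod) (auto simp: galois_B)
      finally show False
        using P(3) by (simp add: \<pp>_emb_iff)
    qed
    then interpret split_prime_over L P \<pp> "\<sigma> \<beta>" r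
      using \<sigma> \<beta>B by unfold_locales (auto simp: galois_B)
    show ?thesis
      using unramified frobenius_eq_id by blast
  qed
  ultimately show ?thesis
    by (elim contrapos_nn finite_subset[rotated]) blast
qed

end

section \<open>Polynomial evaluation in \<A>, componentwise up to finitely many primes\<close>

subsection \<open>The ring \<open>\<A>\<^sub>K\<close>\<close>

lemma product_ring_simps:
  "carrier (product_ring I S) = (\<Pi>\<^sub>E i\<in>I. carrier (S i))"
  "x \<otimes>\<^bsub>product_ring I S\<^esub> y = (\<lambda>i\<in>I. x i \<otimes>\<^bsub>S i\<^esub> y i)"
  "\<one>\<^bsub>product_ring I S\<^esub> = (\<lambda>i\<in>I. \<one>\<^bsub>S i\<^esub>)"
  "x \<oplus>\<^bsub>product_ring I S\<^esub> y = (\<lambda>i\<in>I. x i \<oplus>\<^bsub>S i\<^esub> y i)"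
  "\<zero>\<^bsub>product_ring I S\<^esub> = (\<lambda>i\<in>I. \<zero>\<^bsub>S i\<^esub>)"
  by (simp_all add: product_ring_def)

lemma cring_product_ring:
  assumes S: "\<And>i. i \<in> I \<Longrightarrow> cring (S i)"
  shows "cring (product_ring I S)"
proof -
  have ring: "ring (S i)" if "i \<in> I" for i
    using S[OF that] by (rule cring.axioms(1))
  have mem: "x i \<in> carrier (S i)" if "x \<in> (\<Pi>\<^sub>E i\<in>I. carrier (S i))" "i \<in> I" for x i
    using that by (rule PiE_mem)
  show ?thesis
  proof (rule cringI)
    show "abelian_group (product_ring I S)"
    proof (rule abelian_groupI, unfold product_ring_simps)
      fix x assume x: "x \<in> (\<Pi>\<^sub>E i\<in>I. carrier (S i))"
      show "\<exists>y\<in>\<Pi>\<^sub>E i\<in>I. carrier (S i). (\<lambda>i\<in>I. y i \<oplus>\<^bsub>S i\<^esub> x i) = (\<lambda>i\<in>I. \<zero>\<^bsub>S i\<^esub>)"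
      proof (intro bexI[of _ "\<lambda>i\<in>I. \<ominus>\<^bsub>S i\<^esub> x i"] restrict_ext)
        fix i assume "i \<in> I"
        then show "(\<lambda>i\<in>I. \<ominus>\<^bsub>S i\<^esub> x i) i \<oplus>\<^bsub>S i\<^esub> x i = \<zero>\<^bsub>S i\<^esub>"
          using x ring.ring_simprules(9)[OF ring] by (auto simp: mem)
      next
        show "(\<lambda>i\<in>I. \<ominus>\<^bsub>S i\<^esub> x i) \<in> (\<Pi>\<^sub>E i\<in>I. carrier (S i))"
          using x ring.ring_simprules(3)[OF ring] by (auto simp: mem)
      qed
    next
      fix x y assume xy: "x \<in> (\<Pi>\<^sub>E i\<in>I. carrier (S i))" "y \<in> (\<Pi>\<^sub>E i\<in>I. carrier (S i))"
      show "(\<lambda>i\<in>I. x i \<oplus>\<^bsub>S i\<^esub> y i) \<in> (\<Pi>\<^sub>E i\<in>I. carrier (S i))"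
        using xy ring.ring_simprules(1)[OF ring] by (auto simp: mem)
      show "(\<lambda>i\<in>I. x i \<oplus>\<^bsub>S i\<^esub> y i) = (\<lambda>i\<in>I. y i \<oplus>\<^bsub>S i\<^esub> x i)"
        using xy ring.ring_simprules(10)[OF ring] by (intro restrict_ext) (auto simp: mem)
      fix z assume z: "z \<in> (\<Pi>\<^sub>E i\<in>I. carrier (S i))"
      show "(\<lambda>i\<in>I. (\<lambda>i\<in>I. x i \<oplus>\<^bsub>S i\<^esub> y i) i \<oplus>\<^bsub>S i\<^esub> z i) =
          (\<lambda>i\<in>I. x i \<oplus>\<^bsub>S i\<^esub> (\<lambda>i\<in>I. y i \<oplus>\<^bsub>S i\<^esub> z i) i)"
        using xy z ring.ring_simprules(7)[OF ring] by (intro restrict_ext) (auto simp: mem)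
    next
      show "(\<lambda>i\<in>I. \<zero>\<^bsub>S i\<^esub>) \<in> (\<Pi>\<^sub>E i\<in>I. carrier (S i))"
        using ring.ring_simprules(2)[OF ring] by auto
    next
      fix x assume x: "x \<in> (\<Pi>\<^sub>E i\<in>I. carrier (S i))"
      have "(\<lambda>i\<in>I. (\<lambda>i\<in>I. \<zero>\<^bsub>S i\<^esub>) i \<oplus>\<^bsub>S i\<^esub> x i) = restrict x I"
        using x ring.ring_simprules(8)[OF ring] by (intro restrict_ext) (simp add: mem)
      also have "\<dots> = x"
        using x by (rule PiE_restrict)
      finally show "(\<lambda>i\<in>I. (\<lambda>i\<in>I. \<zero>\<^bsub>S i\<^esub>) i \<oplus>\<^bsub>S i\<^esub> x i) = x" .
    qed
  next
    show "Group.comm_monoid (product_ring I S)"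
    proof (rule comm_monoidI, unfold product_ring_simps)
      fix x y assume xy: "x \<in> (\<Pi>\<^sub>E i\<in>I. carrier (S i))" "y \<in> (\<Pi>\<^sub>E i\<in>I. carrier (S i))"
      show "(\<lambda>i\<in>I. x i \<otimes>\<^bsub>S i\<^esub> y i) \<in> (\<Pi>\<^sub>E i\<in>I. carrier (S i))"
        using xy ring.ring_simprules(5)[OF ring] by (auto simp: mem)
      show "(\<lambda>i\<in>I. x i \<otimes>\<^bsub>S i\<^esub> y i) = (\<lambda>i\<in>I. y i \<otimes>\<^bsub>S i\<^esub> x i)"
        using xy cring.cring_simprules(14)[OF S] by (intro restrict_ext) (auto simp: mem)
      fix z assume z: "z \<in> (\<Pi>\<^sub>E i\<in>I. carrier (S i))"
      show "(\<lambda>i\<in>I. (\<lambda>i\<in>I. x i \<otimes>\<^bsub>S i\<^esub> y i) i \<otimes>\<^bsub>S i\<^esub> z i) =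
          (\<lambda>i\<in>I. x i \<otimes>\<^bsub>S i\<^esub> (\<lambda>i\<in>I. y i \<otimes>\<^bsub>S i\<^esub> z i) i)"
        using xy z ring.ring_simprules(11)[OF ring] by (intro restrict_ext) (auto simp: mem)
    next
      show "(\<lambda>i\<in>I. \<one>\<^bsub>S i\<^esub>) \<in> (\<Pi>\<^sub>E i\<in>I. carrier (S i))"
        using ring.ring_simprules(6)[OF ring] by auto
    next
      fix x assume x: "x \<in> (\<Pi>\<^sub>E i\<in>I. carrier (S i))"
      have "(\<lambda>i\<in>I. (\<lambda>i\<in>I. \<one>\<^bsub>S i\<^esub>) i \<otimes>\<^bsub>S i\<^esub> x i) = restrict x I"
        using x ring.ring_simprules(12)[OF ring] by (intro restrict_ext) (simp add: mem)
      also have "\<dots> = x"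
        using x by (rule PiE_restrict)
      finally show "(\<lambda>i\<in>I. (\<lambda>i\<in>I. \<one>\<^bsub>S i\<^esub>) i \<otimes>\<^bsub>S i\<^esub> x i) = x" .
    qed
  next
    fix x y z
    assume "x \<in> carrier (product_ring I S)" "y \<in> carrier (product_ring I S)" "z \<in> carrier (product_ring I S)"
    then show "(x \<oplus>\<^bsub>product_ring I S\<^esub> y) \<otimes>\<^bsub>product_ring I S\<^esub> z =
        x \<otimes>\<^bsub>product_ring I S\<^esub> z \<oplus>\<^bsub>product_ring I S\<^esub> y \<otimes>\<^bsub>product_ring I S\<^esub> z"
      unfolding product_ring_simps using ring.ring_simprules(13)[OF ring]
      by (intro restrict_ext) (auto simp: mem)
  qed
qed

lemma ideal_direct_sum:
  assumes S: "\<And>i. i \<in> I \<Longrightarrow> cring (S i)"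
  shows "ideal (direct_sum I S) (product_ring I S)"
proof -
  interpret R: cring "product_ring I S"
    using S by (rule cring_product_ring)
  have ring: "ring (S i)" if "i \<in> I" for i
    using S[OF that] by (rule cring.axioms(1))
  have mem: "x i \<in> carrier (S i)" if "x \<in> (\<Pi>\<^sub>E i\<in>I. carrier (S i))" "i \<in> I" for x i
    using that by (rule PiE_mem)
  have closed: "x \<otimes>\<^bsub>product_ring I S\<^esub> a \<in> direct_sum I S"
    if "a \<in> direct_sum I S" "x \<in> carrier (product_ring I S)" for a x
  proof -
    have "{i \<in> I. (x \<otimes>\<^bsub>product_ring I S\<^esub> a) i \<noteq> \<zero>\<^bsub>S i\<^esub>} \<subseteq> {i \<in> I. a i \<noteq> \<zero>\<^bsub>S i\<^esub>}"
      using that(2) ring.ring_simprules(25)[OF ring]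
      by (auto simp: product_ring_simps mem)
    then show ?thesis
      using that finite_subset unfolding direct_sum_def by auto
  qed
  show ?thesis
  proof (rule idealI)
    show "ring (product_ring I S)"
      by (rule R.ring_axioms)
    show "subgroup (direct_sum I S) (add_monoid (product_ring I S))"
    proof (rule R.add.subgroupI)
      show "direct_sum I S \<subseteq> carrier (product_ring I S)"
        by (auto simp: direct_sum_def)
      have "\<zero>\<^bsub>product_ring I S\<^esub> \<in> direct_sum I S"
        using R.zero_closed by (simp add: direct_sum_def product_ring_simps(5))
      then show "direct_sum I S \<noteq> {}"
        by blast
    next
      fix a assume a: "a \<in> direct_sum I S"
      \<comment> \<open>Writing -a as (-1) a reduces closure under negation to absorption of
        products, with no componentwise formula for negatives.\<close>
      then have "\<ominus>\<^bsub>product_ring I S\<^esub> a = \<ominus>\<^bsub>product_ring I S\<^esub> \<one>\<^bsub>product_ring I S\<^esub> \<otimes>\<^bsub>product_ring I S\<^esub> a"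
        using R.l_minus[of "\<one>\<^bsub>product_ring I S\<^esub>" a] by (simp add: direct_sum_def)
      then show "\<ominus>\<^bsub>product_ring I S\<^esub> a \<in> direct_sum I S"
        using closed[OF a] by simp
    next
      fix a b assume ab: "a \<in> direct_sum I S" "b \<in> direct_sum I S"
      have "{i \<in> I. (a \<oplus>\<^bsub>product_ring I S\<^esub> b) i \<noteq> \<zero>\<^bsub>S i\<^esub>} \<subseteq>
          {i \<in> I. a i \<noteq> \<zero>\<^bsub>S i\<^esub>} \<union> {i \<in> I. b i \<noteq> \<zero>\<^bsub>S i\<^esub>}"
        using ring.ring_simprules(8)[OF ring ring.ring_simprules(2)[OF ring]]
        by (auto simp: product_ring_simps)
      then show "a \<oplus>\<^bsub>product_ring I S\<^esub> b \<in> direct_sum I S"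
        using ab finite_subset unfolding direct_sum_def by auto
    qed
  next
    fix a x assume ax: "a \<in> direct_sum I S" "x \<in> carrier (product_ring I S)"
    then show "x \<otimes>\<^bsub>product_ring I S\<^esub> a \<in> direct_sum I S"
      by (rule closed)
    then show "a \<otimes>\<^bsub>product_ring I S\<^esub> x \<in> direct_sum I S"
      using ax R.m_comm[of a x] by (simp add: direct_sum_def)
  qed
qed

text \<open>Used for three homomorphisms: R to R/(P), the product ring to its quotient
  \<open>AK\<close>, and the product ring to its component at P.\<close>

lemma (in ring_hom_cring) hom_poly_eval:
  assumes "\<And>i. i \<in> A \<Longrightarrow> c i \<in> carrier R" "x \<in> carrier R"
  shows "h (\<Oplus>\<^bsub>R\<^esub>i\<in>A. c i \<otimes>\<^bsub>R\<^esub> x [^]\<^bsub>R\<^esub> (i :: nat)) = (\<Oplus>\<^bsub>S\<^esub>i\<in>A. h (c i) \<otimes>\<^bsub>S\<^esub> h x [^]\<^bsub>S\<^esub> i)"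
proof -
  have "h (\<Oplus>\<^bsub>R\<^esub>i\<in>A. c i \<otimes>\<^bsub>R\<^esub> x [^]\<^bsub>R\<^esub> i) = (\<Oplus>\<^bsub>S\<^esub>i\<in>A. (h \<circ> (\<lambda>i. c i \<otimes>\<^bsub>R\<^esub> x [^]\<^bsub>R\<^esub> i)) i)"
    using assms by (subst hom_finsum) (auto simp: comp_def)
  also have "\<dots> = (\<Oplus>\<^bsub>S\<^esub>i\<in>A. h (c i) \<otimes>\<^bsub>S\<^esub> h x [^]\<^bsub>S\<^esub> i)"
    using assms by (intro S.finsum_cong') (auto simp: hom_nat_pow)
  finally show ?thesis .
qed

lemma ideal_prime_ideal_of: "ideal (prime_ideal_of P) ring_of_type_algebra"
  unfolding prime_ideal_of_def by (rule cring.cgenideal_ideal[OF cring_from_type_algebra]) simp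

lemma cring_residue_field: "cring (residue_field P)"
  unfolding residue_field_def
  by (rule ideal.quotient_is_cring[OF ideal_prime_ideal_of cring_from_type_algebra])

lemma residue_class_hom: "ring_hom_cring ring_of_type_algebra (residue_field P) (residue_class P)"
proof -
  have "residue_class P \<in> Ring.ring_hom ring_of_type_algebra (residue_field P)"
    using ideal.rcos_ring_hom[OF ideal_prime_ideal_of, of P]
    by (simp add: residue_class_def[abs_def] residue_field_def)
  then show ?thesis
    by (intro ring_hom_cring.intro ring_hom_cring_axioms.intro cring_from_type_algebra cring_residue_field)
qed

lemma residue_class_eq_zero_iff: "residue_class P r = \<zero>\<^bsub>residue_field P\<^esub> \<longleftrightarrow> P dvd r"
proof -
  interpret I: ideal "prime_ideal_of P" "ring_of_type_algebra"
    by (rule ideal_prime_ideal_of)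
  have "\<zero>\<^bsub>residue_field P\<^esub> = prime_ideal_of P"
    by (simp add: residue_field_def FactRing_def)
  then show ?thesis
    unfolding residue_class_def
    using I.a_rcos_const[of r] I.a_rcos_self[of r] mem_prime_ideal_of_iff[of r P] by auto
qed

lemma residue_class_closed: "residue_class P r \<in> carrier (residue_field P)"
proof -
  interpret ring_hom_cring ring_of_type_algebra "residue_field P" "residue_class P"
    by (rule residue_class_hom)
  show ?thesis
    using hom_closed[of r] by simp
qed

lemma finsum_ring_of_type_algebra:
  fixes f :: "'b \<Rightarrow> 'c::comm_ring_1"
  assumes "finite A"
  shows "finsum ring_of_type_algebra f A = sum f A"
proof -
  interpret cring "ring_of_type_algebra :: 'c ring"
    by (rule cring_from_type_algebra)
  show ?thesis
    using assms by (induction A) auto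
qed

lemma nat_pow_ring_of_type_algebra:
  "x [^]\<^bsub>ring_of_type_algebra\<^esub> (n :: nat) = (x :: 'c::comm_ring_1) ^ n"
  by (induction n) (auto simp: nat_pow_def mult.commute)

lemma residue_class_poly_eval_eq_zeroD:
  assumes "(\<Oplus>\<^bsub>residue_field P\<^esub>i\<in>{..n}. residue_class P (c i) \<otimes>\<^bsub>residue_field P\<^esub>
             residue_class P r [^]\<^bsub>residue_field P\<^esub> (i :: nat)) = \<zero>\<^bsub>residue_field P\<^esub>"
  shows "P dvd (\<Sum>i\<le>n. c i * r ^ i)"
proof -
  interpret ring_hom_cring ring_of_type_algebra "residue_field P" "residue_class P"
    by (rule residue_class_hom)
  have "residue_class P (\<Sum>i\<le>n. c i * r ^ i) = \<zero>\<^bsub>residue_field P\<^esub>"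
    using hom_poly_eval[of "{..n}" c r] assms
    by (simp add: finsum_ring_of_type_algebra nat_pow_ring_of_type_algebra)
  then show ?thesis
    by (simp add: residue_class_eq_zero_iff)
qed

text \<open>The polynomial expression is formed in the product ring as y. The quotient map sends y
  to \<open>AK_eval\<close>, so y lies in the direct sum, and projection to P identifies the
  component of y with the expression in R/(P).\<close>

lemma AK_eval_eq_zeroD:
  assumes a: "\<And>P. P \<in> monic_primes \<Longrightarrow> a P \<in> carrier (residue_field P)"
    and c: "\<And>P i. P \<in> monic_primes \<Longrightarrow> reduce_ratfun P (Polynomial.coeff f i) \<in> carrier (residue_field P)"
    and eval: "AK_eval f (AK_class a) = \<zero>\<^bsub>AK\<^esub>"
  shows "finite {P \<in> monic_primes. (\<Oplus>\<^bsub>residue_field P\<^esub>i\<in>{..Polynomial.degree f}.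
    reduce_ratfun P (Polynomial.coeff f i) \<otimes>\<^bsub>residue_field P\<^esub> a P [^]\<^bsub>residue_field P\<^esub> i)
    \<noteq> \<zero>\<^bsub>residue_field P\<^esub>}"
proof -
  let ?R = "product_ring monic_primes residue_field"
  let ?J = "direct_sum monic_primes residue_field"
  let ?c = "\<lambda>i. restrict (\<lambda>P. reduce_ratfun P (Polynomial.coeff f i)) monic_primes"
  let ?a = "restrict a monic_primes"
  define y where "y = (\<Oplus>\<^bsub>?R\<^esub>i\<in>{..Polynomial.degree f}. ?c i \<otimes>\<^bsub>?R\<^esub> ?a [^]\<^bsub>?R\<^esub> i)"
  have crR: "cring ?R"
    by (intro cring_product_ring cring_residue_field)
  then interpret R: cring ?R .
  interpret J: ideal ?J ?R
    by (intro ideal_direct_sum cring_residue_field)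
  have cl: "ring_hom_cring ?R AK (\<lambda>x. ?J +>\<^bsub>?R\<^esub> x)"
    unfolding AK_def using J.rcos_ring_hom J.quotient_is_cring[OF crR] crR
    by (intro ring_hom_cring.intro ring_hom_cring_axioms.intro) 
  have ca: "?a \<in> carrier ?R" "\<And>i. ?c i \<in> carrier ?R"
    using a c by (auto simp: product_ring_simps)
  have "?J +>\<^bsub>?R\<^esub> y = AK_eval f (AK_class a)"
    unfolding y_def AK_eval_def ratfun_to_AK_def AK_class_def
    using ca by (intro ring_hom_cring.hom_poly_eval[OF cl])
  then have "?J +>\<^bsub>?R\<^esub> y = ?J"
    using eval by (simp add: AK_def FactRing_def)
  moreover have "y \<in> carrier ?R"
    unfolding y_def using ca by (intro R.finsum_closed) auto
  ultimately have "y \<in> ?J"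
    using J.a_rcos_self[of y] by simp
  then have fin: "finite {P \<in> monic_primes. y P \<noteq> \<zero>\<^bsub>residue_field P\<^esub>}"
    unfolding direct_sum_def by blast
  have yP: "y P = (\<Oplus>\<^bsub>residue_field P\<^esub>i\<in>{..Polynomial.degree f}.
      reduce_ratfun P (Polynomial.coeff f i) \<otimes>\<^bsub>residue_field P\<^esub> a P [^]\<^bsub>residue_field P\<^esub> i)"
    if P: "P \<in> monic_primes" for P
  proof -
    have "(\<lambda>x. x P) \<in> Ring.ring_hom ?R (residue_field P)"
      using P by (auto simp: Ring.ring_hom_def product_ring_simps)
    then have pr: "ring_hom_cring ?R (residue_field P) (\<lambda>x. x P)"
      by (intro ring_hom_cring.intro ring_hom_cring_axioms.intro crR cring_residue_field)
    show ?thesis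
      unfolding y_def using ring_hom_cring.hom_poly_eval[OF pr, of "{..Polynomial.degree f}" ?c ?a] ca P
      by simp
  qed
  show ?thesis
    using fin by (rule rev_finite_subset) (use yP in force)
qed

section \<open>Reduction of elements of K modulo P\<close>

subsection \<open>Reduction of rational functions\<close>

text \<open>The condition \<open>cong_at\<close> for R and (P) with representatives made explicit: k
  lies in the localization of R at (P) and is congruent to r there.\<close>

definition reduces_to :: "'a::field poly \<Rightarrow> 'a ratfun \<Rightarrow> 'a poly \<Rightarrow> bool"
  where "reduces_to P k r \<longleftrightarrow> (\<exists>s t. \<not> P dvd s \<and> to_fract s * (k - to_fract r) = to_fract (P * t))"

lemma cong_at_ratfun_iff:
  "cong_at (range poly_to_ratfun) (poly_to_ratfun ` prime_ideal_of P) k (poly_to_ratfun r) \<longleftrightarrow> reduces_to P k r"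
proof
  assume "cong_at (range poly_to_ratfun) (poly_to_ratfun ` prime_ideal_of P) k (poly_to_ratfun r)"
  then obtain s t where "to_fract s \<notin> to_fract ` prime_ideal_of P"
    "to_fract s * (k - to_fract r) = to_fract t" "t \<in> prime_ideal_of P"
    unfolding cong_at_def to_fract_def by blast
  moreover from this have "\<not> P dvd s"
    using mem_prime_ideal_of_iff by blast
  ultimately show "reduces_to P k r"
    unfolding reduces_to_def mem_prime_ideal_of_iff by (metis dvdE)
next
  assume "reduces_to P k r"
  then obtain s t where st: "\<not> P dvd s" "to_fract s * (k - to_fract r) = to_fract (P * t)"
    unfolding reduces_to_def by blast
  have "to_fract s \<in> range to_fract - to_fract ` prime_ideal_of P"
    using st(1) mem_prime_ideal_of_iff by (auto simp del: to_fract_eq_iff dest: to_fract_eq_iff[THEN iffD1])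
  moreover have "to_fract s * (k - to_fract r) \<in> to_fract ` prime_ideal_of P"
    unfolding st(2) by (intro imageI) (simp add: mem_prime_ideal_of_iff)
  ultimately show "cong_at (range poly_to_ratfun) (poly_to_ratfun ` prime_ideal_of P) k (poly_to_ratfun r)"
    unfolding cong_at_def to_fract_def by blast
qed

text \<open>The denominator v itself serves as multiplier in one direction; in the other, an
  arbitrary multiplier s prime to P is cancelled.\<close>

lemma reduces_to_divide_iff:
  assumes P: "irreducible P" and v: "\<not> P dvd v"
  shows "reduces_to P (to_fract u / to_fract v) r \<longleftrightarrow> P dvd u - v * r"
proof -
  have v0: "v \<noteq> 0"
    using v by auto
  have eq: "to_fract v * (to_fract u / to_fract v - to_fract r) = to_fract (u - v * r)"
    using v0 by (simp add: right_diff_distrib)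
  show ?thesis
  proof
    assume "reduces_to P (to_fract u / to_fract v) r"
    then obtain s t where st: "\<not> P dvd s" "to_fract s * (to_fract u / to_fract v - to_fract r) = to_fract (P * t)"
      unfolding reduces_to_def by blast
    have "to_fract (s * (u - v * r)) = to_fract v * (to_fract s * (to_fract u / to_fract v - to_fract r))"
      unfolding to_fract_mult eq[symmetric] by (simp only: mult.left_commute)
    also have "\<dots> = to_fract (P * (v * t))"
      unfolding st(2) by (simp add: mult.left_commute)
    finally have "s * (u - v * r) = P * (v * t)"
      unfolding to_fract_eq_iff .
    then have "P dvd s * (u - v * r)"
      by simp
    then show "P dvd u - v * r"
      using irreducible_dvd_mult_iff[OF P] st(1) by blast
  next
    assume "P dvd u - v * r"
    then obtain t where "u - v * r = P * t" ..
    then show "reduces_to P (to_fract u / to_fract v) r"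
      unfolding reduces_to_def using v eq by metis
  qed
qed

lemma exists_reduces_to:
  assumes P: "irreducible (P :: 'a::{field, finite} poly)" and v: "\<not> P dvd v"
  obtains r where "reduces_to P (to_fract u / to_fract v) r"
proof -
  obtain w where "P dvd v * w - 1"
    using irreducible_inverse_mod[OF P v] .
  then have "P dvd (- u) * (v * w - 1)"
    by (rule dvd_mult)
  also have "(- u) * (v * w - 1) = u - v * (w * u)"
    by (simp add: algebra_simps)
  finally show ?thesis
    using that reduces_to_divide_iff[OF P v] by blast
qed

lemma reduces_to_add:
  assumes P: "irreducible P" and "reduces_to P x r" "reduces_to P y r'"
  shows "reduces_to P (x + y) (r + r')"
proof -
  obtain s t where s: "\<not> P dvd s" "to_fract s * (x - to_fract r) = to_fract (P * t)"
    using assms(2) unfolding reduces_to_def by blast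
  obtain s' t' where s': "\<not> P dvd s'" "to_fract s' * (y - to_fract r') = to_fract (P * t')"
    using assms(3) unfolding reduces_to_def by blast
  have "to_fract (s * s') * (x + y - to_fract (r + r')) =
      to_fract s' * (to_fract s * (x - to_fract r)) + to_fract s * (to_fract s' * (y - to_fract r'))"
    by (simp add: algebra_simps)
  also have "\<dots> = to_fract (P * (s' * t + s * t'))"
    unfolding s(2) s'(2) by (simp add: algebra_simps)
  finally show ?thesis
    unfolding reduces_to_def using irreducible_dvd_mult_iff[OF P] s(1) s'(1) by blast
qed

lemma reduces_to_mult:
  assumes P: "irreducible P" and "reduces_to P x r" "reduces_to P y r'"
  shows "reduces_to P (x * y) (r * r')"
proof -
  obtain s t where s: "\<not> P dvd s" "to_fract s * (x - to_fract r) = to_fract (P * t)"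
    using assms(2) unfolding reduces_to_def by blast
  obtain s' t' where s': "\<not> P dvd s'" "to_fract s' * (y - to_fract r') = to_fract (P * t')"
    using assms(3) unfolding reduces_to_def by blast
  \<comment> \<open>Expansion of x y - r r' as (x - r)(y - r') + r (y - r') + r' (x - r).\<close>
  have "to_fract (s * s') * (x * y - to_fract (r * r')) =
      (to_fract s * (x - to_fract r)) * (to_fract s' * (y - to_fract r')) +
      to_fract (r * s) * (to_fract s' * (y - to_fract r')) + to_fract (r' * s') * (to_fract s * (x - to_fract r))"
    by (simp add: algebra_simps)
  also have "\<dots> = to_fract (P * (t * (P * t') + r * s * t' + r' * s' * t))"
    unfolding s(2) s'(2) by (simp add: algebra_simps)
  finally show ?thesis
    unfolding reduces_to_def using irreducible_dvd_mult_iff[OF P] s(1) s'(1) by blast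
qed

lemma reduces_to_to_fract:
  assumes "irreducible P"
  shows "reduces_to P (to_fract r) r"
proof -
  have "\<not> P dvd 1"
    using assms unfolding irreducible_def by blast
  moreover have "to_fract 1 * (to_fract r - to_fract r) = to_fract (P * 0)"
    by simp
  ultimately show ?thesis
    unfolding reduces_to_def by blast
qed

lemma reduces_to_power:
  assumes "irreducible P" "reduces_to P x r"
  shows "reduces_to P (x ^ n) (r ^ n)"
proof (induction n)
  case 0
  show ?case
    using reduces_to_to_fract[OF assms(1), of 1] by simp
next
  case (Suc n)
  then show ?case
    using reduces_to_mult[OF assms] by simp
qed

lemma reduces_to_sum:
  assumes "irreducible P" "finite A" "\<And>a. a \<in> A \<Longrightarrow> reduces_to P (f a) (g a)"
  shows "reduces_to P (sum f A) (sum g A)"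
  using assms(2,3)
proof (induction A)
  case empty
  show ?case
    using reduces_to_to_fract[OF assms(1), of 0] by simp
next
  case (insert a A)
  then show ?case
    using reduces_to_add[OF assms(1)] by simp
qed

lemma reduce_ratfun_eq:
  "reduce_ratfun P k = (if \<exists>r. reduces_to P k r then residue_class P (SOME r. reduces_to P k r)
     else \<zero>\<^bsub>residue_field P\<^esub>)"
  unfolding reduce_ratfun_def Let_def cong_at_ratfun_iff ..

lemma reduce_ratfun_closed: "reduce_ratfun P k \<in> carrier (residue_field P)"
  unfolding reduce_ratfun_eq
  by (simp add: residue_class_closed cring.cring_simprules(2)[OF cring_residue_field])

text \<open>The representative picked by \<open>SOME\<close> is known only to satisfy
  \<open>reduces_to\<close>. This suffices, as that relation is compatible with sums and
  products.\<close>

lemma exists_reduce_ratfun: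
  assumes "reduces_to P k r0"
  obtains r where "reduces_to P k r" "reduce_ratfun P k = residue_class P r"
proof -
  have "\<exists>r. reduces_to P k r"
    using assms by blast
  then show ?thesis
    using that[of "SOME r. reduces_to P k r"] someI_ex[of "reduces_to P k"] by (simp add: reduce_ratfun_eq)
qed

lemma frobenius_value_closed: "frobenius_value L g P \<in> carrier (residue_field P)"
  unfolding frobenius_value_def Let_def
  by (simp add: residue_class_closed cring.cring_simprules(2)[OF cring_residue_field])

section \<open>Values at split primes and descent of the equation to K\<close>

context galois_ext
begin

text \<open>At a split prime every Frobenius is \<iota>, so the defining condition of
  \<open>frobenius_value\<close> involves only g(\<iota>) = u/v. For each \<pp> it amounts to P
  dividing u - v r, which is the condition for reducing u/v modulo P.\<close>

lemma exists_frobenius_value: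
  assumes P: "P \<in> monic_primes" and v: "\<not> P dvd v"
    and split: "\<forall>\<pp>\<in>primes_over L P. unramified L P \<pp> \<and> frobenius L P \<pp> = \<iota>"
    and g: "g \<iota> = to_ac (to_fract u / to_fract v)"
  obtains r where "reduces_to P (to_fract u / to_fract v) r" "frobenius_value L g P = residue_class P r"
proof -
  have irr: "irreducible P"
    using P by (simp add: monic_primes_def)
  have v0: "v \<noteq> 0"
    using v by auto
  have eq: "emb v * (g \<iota> - emb r) = emb (u - v * r)" for r
    unfolding g using v0 by (simp add: emb_def right_diff_distrib)
  have "cong_at B \<pp> (g \<iota>) (emb r) \<longleftrightarrow> P dvd u - v * r" if \<pp>: "\<pp> \<in> primes_over L P" for \<pp> r
  proof -
    interpret prime_over L P \<pp>
      by unfold_locales (fact P \<pp>)+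
    show ?thesis
    proof
      assume "cong_at B \<pp> (g \<iota>) (emb r)"
      then obtain s where s: "s \<in> B" "s \<notin> \<pp>" "s * (g \<iota> - emb r) \<in> \<pp>"
        unfolding cong_at_def by blast
      from s(3) have "emb v * (s * (g \<iota> - emb r)) \<in> \<pp>"
        by (rule \<pp>_mult[OF B_closed(3)])
      also have "emb v * (s * (g \<iota> - emb r)) = s * emb (u - v * r)"
        unfolding eq[symmetric] by (rule mult.left_commute)
      finally have "emb (u - v * r) \<in> \<pp>"
        using \<pp>_prime[of s "emb (u - v * r)"] s(1,2) by blast
      then show "P dvd u - v * r"
        unfolding \<pp>_emb_iff .
    next
      assume "P dvd u - v * r"
      then have "emb v * (g \<iota> - emb r) \<in> \<pp>"
        unfolding eq \<pp>_emb_iff .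
      moreover have "emb v \<in> B - \<pp>"
        using v by (simp add: \<pp>_emb_iff)
      ultimately show "cong_at B \<pp> (g \<iota>) (emb r)"
        unfolding cong_at_def by blast
    qed
  qed
  \<comment> \<open>The direction from left to right uses that some \<pp> over P exists.\<close>
  then have rep: "(\<forall>\<pp>\<in>primes_over L P. unramified L P \<pp> \<and> cong_at B \<pp> (g (frobenius L P \<pp>)) (poly_to_bar r))
      \<longleftrightarrow> reduces_to P (to_fract u / to_fract v) r" for r
    using split primes_over_nonempty[OF P] unfolding reduces_to_divide_iff[OF irr v] poly_to_bar_eq_emb
    by (metis ex_in_conv)
  obtain r0 where "reduces_to P (to_fract u / to_fract v) r0"
    using exists_reduces_to[OF irr v] .
  then have ex: "\<exists>r. reduces_to P (to_fract u / to_fract v) r"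
    by blast
  then have "frobenius_value L g P = residue_class P (SOME r. reduces_to P (to_fract u / to_fract v) r)"
    unfolding frobenius_value_def Let_def rep by simp
  then show ?thesis
    using that someI_ex[OF ex] by blast
qed

text \<open>Conjugation fixes \<iota>, so equivariance says that every \<sigma> fixes
  g(\<iota>).\<close>

lemma equivariant_one:
  assumes "g \<in> equivariant_maps L"
  obtains k where "g \<iota> = to_ac k"
proof -
  interpret G: group "galois_group L"
    by (rule group_galois_group)
  have "g \<iota> \<in> L"
    using assms galois_one unfolding equivariant_maps_def by blast
  moreover have "\<sigma> (g \<iota>) = g \<iota>" if \<sigma>: "\<sigma> \<in> \<Gamma>" for \<sigma>
  proof -
    have "g (\<sigma> \<otimes>\<^bsub>galois_group L\<^esub> \<iota> \<otimes>\<^bsub>galois_group L\<^esub> inv\<^bsub>galois_group L\<^esub> \<sigma>) = \<sigma> (g \<iota>)"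
      using assms \<sigma> galois_one unfolding equivariant_maps_def by blast
    then show ?thesis
      using \<sigma> by simp
  qed
  ultimately have "g \<iota> \<in> range to_ac"
    by (rule fixed_in_range_to_ac)
  then show ?thesis
    using that by blast
qed

text \<open>The root is k = g(\<iota>): the numerator of f(k) would otherwise be a nonzero
  polynomial divisible by infinitely many primes.\<close>

lemma root_of_ev_root:
  assumes g: "g \<in> equivariant_maps L" and eval: "AK_eval f (ev L g) = \<zero>\<^bsub>AK\<^esub>"
  shows "\<exists>x. poly f x = 0"
proof -
  obtain k where k: "g \<iota> = to_ac k"
    using equivariant_one[OF g] .
  obtain u v where uv: "v \<noteq> 0" "k = to_fract u / to_fract v"
    by (rule ratfun_cases)
  obtain x y where xy: "y \<noteq> 0" "poly f k = to_fract x / to_fract y"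
    by (rule ratfun_cases)
  \<comment> \<open>For P not dividing d, every coefficient of f can be reduced modulo P.\<close>
  obtain d where d0: "d \<noteq> 0"
    and d: "\<And>c. c \<in> range (Polynomial.coeff f) \<Longrightarrow> \<exists>r. to_fract d * c = to_fract r"
  proof (rule common_denominator)
    show "finite (range (Polynomial.coeff f))"
      by (simp add: range_coeff)
  qed blast
  have den: "\<exists>r. Polynomial.coeff f i = to_fract r / to_fract d" for i
  proof -
    obtain r where "to_fract d * Polynomial.coeff f i = to_fract r"
      using d by blast
    then have "Polynomial.coeff f i = to_fract r / to_fract d"
      using d0 by (simp add: eq_divide_eq mult.commute)
    then show ?thesis ..
  qed
  define Bad where "Bad = {P \<in> monic_primes. (\<Oplus>\<^bsub>residue_field P\<^esub>i\<in>{..Polynomial.degree f}.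
    reduce_ratfun P (Polynomial.coeff f i) \<otimes>\<^bsub>residue_field P\<^esub>
      frobenius_value L g P [^]\<^bsub>residue_field P\<^esub> i) \<noteq> \<zero>\<^bsub>residue_field P\<^esub>}"
  have "finite Bad"
    unfolding Bad_def using eval unfolding ev_def
    by (intro AK_eval_eq_zeroD frobenius_value_closed reduce_ratfun_closed)
  have "x = 0"
  proof (rule ccontr)
    assume "x \<noteq> 0"
    \<comment> \<open>The excluded primes divide the denominators of k, of f(k) or of the
      coefficients, or the numerator x; avoiding the last is what gives the contradiction.\<close>
    then have "v * y * d * x \<noteq> 0"
      using uv(1) xy(1) d0 by simp
    then have "finite (Bad \<union> {P \<in> monic_primes. P dvd v * y * d * x})"
      using \<open>finite Bad\<close> finite_monic_primes_dvd by blast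
    from Diff_infinite_finite[OF this infinite_split_primes]
    have "{P \<in> monic_primes. \<forall>\<pp>\<in>primes_over L P. unramified L P \<pp> \<and> frobenius L P \<pp> = \<iota>} -
        (Bad \<union> {P \<in> monic_primes. P dvd v * y * d * x}) \<noteq> {}"
      by (rule infinite_imp_nonempty)
    then obtain P where P: "P \<in> monic_primes"
      "\<forall>\<pp>\<in>primes_over L P. unramified L P \<pp> \<and> frobenius L P \<pp> = \<iota>"
      "P \<notin> Bad" "\<not> P dvd v * y * d * x"
      by blast
    have irr: "irreducible P"
      using P(1) by (simp add: monic_primes_def)
    have ndvd: "\<not> P dvd v" "\<not> P dvd y" "\<not> P dvd d" "\<not> P dvd x"
      using P(4) irreducible_dvd_mult_iff[OF irr] by blast+
    obtain r where r: "reduces_to P k r" "frobenius_value L g P = residue_class P r"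
      unfolding uv(2) by (rule exists_frobenius_value[where g = g, OF P(1) ndvd(1) P(2) k[unfolded uv(2)]])
    have "\<exists>c. reduces_to P (Polynomial.coeff f i) c \<and>
        reduce_ratfun P (Polynomial.coeff f i) = residue_class P c" for i
    proof -
      obtain n where n: "Polynomial.coeff f i = to_fract n / to_fract d"
        using den by blast
      obtain r0 where "reduces_to P (Polynomial.coeff f i) r0"
        unfolding n by (rule exists_reduces_to[OF irr ndvd(3)])
      then obtain c where "reduces_to P (Polynomial.coeff f i) c"
        "reduce_ratfun P (Polynomial.coeff f i) = residue_class P c"
        by (rule exists_reduce_ratfun)
      then show ?thesis
        by blast
    qed
    then obtain c where c: "\<And>i. reduces_to P (Polynomial.coeff f i) (c i)"
      "\<And>i. reduce_ratfun P (Polynomial.coeff f i) = residue_class P (c i)"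
      by metis
    have "(\<Oplus>\<^bsub>residue_field P\<^esub>i\<in>{..Polynomial.degree f}. reduce_ratfun P (Polynomial.coeff f i)
        \<otimes>\<^bsub>residue_field P\<^esub> frobenius_value L g P [^]\<^bsub>residue_field P\<^esub> i) = \<zero>\<^bsub>residue_field P\<^esub>"
      using P(1,3) unfolding Bad_def by blast
    then have "P dvd (\<Sum>i\<le>Polynomial.degree f. c i * r ^ i)"
      unfolding c(2) r(2) by (rule residue_class_poly_eval_eq_zeroD)
    then have "P dvd y * (\<Sum>i\<le>Polynomial.degree f. c i * r ^ i)"
      by (rule dvd_mult)
    \<comment> \<open>The sum that vanishes modulo P is also a reduction of f(k) = x/y, so P divides
      x.\<close>
    moreover have "reduces_to P (poly f k) (\<Sum>i\<le>Polynomial.degree f. c i * r ^ i)"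
      unfolding poly_altdef by (intro reduces_to_sum reduces_to_mult reduces_to_power irr c r(1)) simp
    then have "P dvd x - y * (\<Sum>i\<le>Polynomial.degree f. c i * r ^ i)"
      unfolding xy(2) reduces_to_divide_iff[OF irr ndvd(2)] .
    ultimately have "P dvd y * (\<Sum>i\<le>Polynomial.degree f. c i * r ^ i) +
        (x - y * (\<Sum>i\<le>Polynomial.degree f. c i * r ^ i))"
      by (rule dvd_add)
    then have "P dvd x"
      by simp
    then show False
      using ndvd(4) by blast
  qed
  then show ?thesis
    using xy(2) by auto
qed

end

theorem theorem1p20:
  fixes \<alpha> :: "('a::{field, finite} poly \<Rightarrow> 'a poly set) set"
    and f :: "'a poly fract poly"
  assumes "\<alpha> \<in> P0_AK"
    and "AK_eval f \<alpha> = \<zero>\<^bsub>AK\<^esub>"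
  shows "\<exists>x. poly f x = 0"
proof -
  obtain L g where "finite_galois L" "g \<in> equivariant_maps L" "\<alpha> = ev L g"
    using assms(1) unfolding P0_AK_def by blast
  then show ?thesis
    using galois_ext.root_of_ev_root[OF galois_ext.intro] assms(2) by blast
qed

end
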